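(* Let $X$ be a Tychonoff space. The following statements are equivalent: (i) $X$ is universally $\tau$-measurable, i.e. $M_\tau(X)=M_R(X)$; (ii) $X$ is $\mu$-measurable in $\beta X$ for every measure $\mu\in P(\beta X)$; (iii) there exists a topological embedding of $X$ into some Tychonoff space $Y$ such that, regarding $X\subset Y\subset \beta Y$, $X$ is $\mu$-measurable for every measure $\mu\in P(\beta Y)$; (iv) for every topological embedding of $X$ into any Tychonoff space $Y$, regarding $X\subset Y\subset\beta Y$, $X$ is $\mu$-measurable for every measure $\mu\in P(\beta Y)$.
   Context: $\beta X$ is the Stone–Čech compactification of $X$. For a compact Hausdorff space $K$, $M(K)$ is the space of finite signed regular Borel measures on $K$ (identified with the dual of the Banach space $C(K)$ of real continuous functions), and $P(K)\subset M(K)$ is the set of probability measures. $|\mu|$ denotes the total variation of $\mu$. For a Tychonoff space $X$ define subsets of $M(\beta X)$: $M_R(X)$ is the set of $\mu\in M(\beta X)$ concentrated on some $\sigma$-compact subset of $X$ (i.e. $|\mu|(\beta X\setminus S)=0$ for some $\sigma$-compact $S\subset X$); $M_\tau(X)$ is the set of $\mu\in M(\beta X)$ with $|\mu|(C)=0$ for every compact $C\subset\beta X\setminus X$. For a compact $K$, a set $A\subset K$ is $\mu$-measurable, $\mu\in P(K)$, if it belongs to the completion of the Borel $\sigma$-algebra of $K$ with respect to $\mu$. *)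

theory Defs
  imports "HOL-Analysis.Analysis"
begin

definition tychonoff_space :: "'a topology \<Rightarrow> bool" where
  "tychonoff_space X \<longleftrightarrow> completely_regular_space X \<and> Hausdorff_space X"

text \<open>The Stone-Cech compactification is the closure of the image of the evaluation map in
  the cube indexed by all continuous functions from the space to the unit interval. Functions are
  taken to be extensional, so that each continuous function is counted exactly once.
  The lemmas below verify the characteristic properties, including the universal one.\<close>

definition unit_functions :: "'a topology \<Rightarrow> ('a \<Rightarrow> real) set" where
  "unit_functions X = {f \<in> topspace X \<rightarrow>\<^sub>E {0..1}. continuous_map X euclideanreal f}"

definition unit_cube :: "'a topology \<Rightarrow> (('a \<Rightarrow> real) \<Rightarrow> real) topology" where
  "unit_cube X = product_topology (\<lambda>_. top_of_set {0..1}) (unit_functions X)"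

definition stone_cech_embed :: "'a topology \<Rightarrow> 'a \<Rightarrow> ('a \<Rightarrow> real) \<Rightarrow> real" where
  "stone_cech_embed X x = (\<lambda>f\<in>unit_functions X. f x)"

definition stone_cech :: "'a topology \<Rightarrow> (('a \<Rightarrow> real) \<Rightarrow> real) topology" where
  "stone_cech X =
     subtopology (unit_cube X) (unit_cube X closure_of (stone_cech_embed X ` topspace X))"

lemma topspace_stone_cech:
  "topspace (stone_cech X) = unit_cube X closure_of (stone_cech_embed X ` topspace X)"
  using closure_of_subset_topspace by (fastforce simp: stone_cech_def)

lemma compact_space_unit_cube: "compact_space (unit_cube X)"
  unfolding unit_cube_def
  by (simp add: compact_space_product_topology compact_space_subtopology)

lemma Hausdorff_space_unit_cube: "Hausdorff_space (unit_cube X)"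
  unfolding unit_cube_def
  by (simp add: Hausdorff_space_product_topology Hausdorff_space_subtopology)

lemma compact_space_stone_cech: "compact_space (stone_cech X)"
  unfolding stone_cech_def
  by (simp add: closedin_compact_space compact_space_subtopology compact_space_unit_cube)

lemma Hausdorff_space_stone_cech: "Hausdorff_space (stone_cech X)"
  unfolding stone_cech_def by (simp add: Hausdorff_space_subtopology Hausdorff_space_unit_cube)

lemma unit_functions_eq:
  "unit_functions X =
     mspace (submetric (cfunspace X euclidean_metric) {f. f \<in> topspace X \<rightarrow> {0..1::real}})"
proof -
  have "bounded (f ` topspace X)" if "f \<in> topspace X \<rightarrow> {0..1::real}" for f
    by (rule bounded_subset[OF bounded_closed_interval[of 0 1]]) (use that in auto)
  then show ?thesis
    by (auto simp: unit_functions_def PiE_def Pi_iff)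
qed

lemma stone_cech_embed_in_cube:
  "stone_cech_embed X ` topspace X \<subseteq> topspace (unit_cube X)"
proof (rule image_subsetI)
  fix x assume "x \<in> topspace X"
  then have "f x \<in> {0..1}" if "f \<in> unit_functions X" for f
    using that unfolding unit_functions_def by blast
  then show "stone_cech_embed X x \<in> topspace (unit_cube X)"
    by (simp add: stone_cech_embed_def unit_cube_def)
qed

lemma stone_cech_embed_image: "stone_cech_embed X ` topspace X \<subseteq> topspace (stone_cech X)"
  by (simp add: closure_of_subset stone_cech_embed_in_cube topspace_stone_cech)

lemma embedding_map_stone_cech:
  assumes "tychonoff_space X"
  shows "embedding_map X (stone_cech X) (stone_cech_embed X)"
proof -
  have "embedding_map X (unit_cube X) (stone_cech_embed X)"
    using completely_regular_space_cube_embedding_explicit[of X] assms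
    unfolding tychonoff_space_def unit_cube_def unit_functions_eq stone_cech_embed_def[abs_def]
    by simp
  then show ?thesis
    using stone_cech_embed_image[of X]
    unfolding topspace_stone_cech by (simp add: stone_cech_def embedding_map_in_subtopology)
qed

lemma dense_stone_cech:
  "stone_cech X closure_of (stone_cech_embed X ` topspace X) = topspace (stone_cech X)"
proof -
  have "stone_cech_embed X ` topspace X \<subseteq> unit_cube X closure_of (stone_cech_embed X ` topspace X)"
    by (simp add: closure_of_subset stone_cech_embed_in_cube)
  then show ?thesis
    by (simp add: topspace_stone_cech) (simp add: stone_cech_def closure_of_subtopology Int_absorb1)
qed

lemma stone_cech_extension:
  fixes X :: "'a topology" and K :: "'b topology"
  assumes "compact_space K" "Hausdorff_space K" and g: "continuous_map X K g"
  shows "\<exists>h. continuous_map (stone_cech X) K h \<and>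
             (\<forall>x\<in>topspace X. h (stone_cech_embed X x) = g x)"
proof -
  have K: "tychonoff_space K"
    using assms by (simp add: tychonoff_space_def normal_imp_completely_regular_space
        compact_Hausdorff_or_regular_imp_normal_space)
  let ?eX = "stone_cech_embed X" and ?eK = "stone_cech_embed K"
  define G :: "(('a \<Rightarrow> real) \<Rightarrow> real) \<Rightarrow> ('b \<Rightarrow> real) \<Rightarrow> real"
    where "G = (\<lambda>p. \<lambda>f\<in>unit_functions K. p (restrict (f \<circ> g) (topspace X)))"
  have pull: "restrict (f \<circ> g) (topspace X) \<in> unit_functions X" if "f \<in> unit_functions K" for f
  proof -
    have "continuous_map X euclideanreal (f \<circ> g)"
      using that g continuous_map_compose by (fastforce simp: unit_functions_def)
    then have "continuous_map X euclideanreal (restrict (f \<circ> g) (topspace X))"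
      by (rule continuous_map_eq) auto
    moreover have "f (g x) \<in> {0..1}" if "x \<in> topspace X" for x
      using \<open>f \<in> _\<close> g that by (auto simp: unit_functions_def continuous_map_def PiE_iff Pi_iff)
    ultimately show ?thesis
      by (auto simp: unit_functions_def)
  qed
  have contG: "continuous_map (unit_cube X) (unit_cube K) G"
    unfolding unit_cube_def G_def continuous_map_componentwise
    using pull by (auto intro!: continuous_map_product_projection)
  have Ge: "G (?eX x) = ?eK (g x)" if "x \<in> topspace X" for x
    using that pull by (auto simp: G_def stone_cech_embed_def fun_eq_iff)
  have gim: "g ` topspace X \<subseteq> topspace K"
    using g by (simp add: continuous_map_image_subset_topspace)
  have emb: "embedding_map K (unit_cube K) ?eK"
    using embedding_map_stone_cech[OF K]
    by (simp add: stone_cech_def embedding_map_in_subtopology)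
  have "compactin (unit_cube K) (?eK ` topspace K)"
    using assms(1) emb
    by (meson compact_space_def embedding_imp_closed_map_eq embedding_map_def
        homeomorphic_imp_continuous_map continuous_map_in_subtopology image_compactin)
  then have clo: "closedin (unit_cube K) (?eK ` topspace K)"
    by (simp add: Hausdorff_space_unit_cube compactin_imp_closedin)
  have "G ` topspace (stone_cech X) \<subseteq> unit_cube K closure_of (G ` ?eX ` topspace X)"
    unfolding topspace_stone_cech by (rule continuous_map_image_closure_subset[OF contG])
  also have "\<dots> \<subseteq> ?eK ` topspace K"
    using gim Ge by (intro closure_of_minimal clo) auto
  finally have Gim: "G ` topspace (stone_cech X) \<subseteq> ?eK ` topspace K" .
  obtain k where k: "homeomorphic_maps K (subtopology (unit_cube K) (?eK ` topspace K)) ?eK k"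
    using emb by (auto simp: embedding_map_def homeomorphic_map_maps)
  have "continuous_map (stone_cech X) (subtopology (unit_cube K) (?eK ` topspace K)) G"
    using contG Gim
    by (auto simp: continuous_map_in_subtopology stone_cech_def continuous_map_from_subtopology)
  then have "continuous_map (stone_cech X) K (k \<circ> G)"
    using k continuous_map_compose by (fastforce simp: homeomorphic_maps_def)
  moreover have "(k \<circ> G) (?eX x) = g x" if "x \<in> topspace X" for x
    using that k gim Ge by (auto simp: homeomorphic_maps_def)
  ultimately show ?thesis by blast
qed

definition borel_sets :: "'a topology \<Rightarrow> 'a set set" where
  "borel_sets K = sigma_sets (topspace K) {U. openin K U}"

text \<open>The total variation of a signed Borel measure: the supremum over the finite Borel
  partitions of the argument. It is meant for Borel arguments only.\<close>

definition total_variation :: "'a topology \<Rightarrow> ('a set \<Rightarrow> real) \<Rightarrow> 'a set \<Rightarrow> ennreal" where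
  "total_variation K \<mu> A =
     (SUP P \<in> {P. finite P \<and> P \<subseteq> borel_sets K \<and> disjoint P \<and> \<Union>P = A}.
        \<Sum>B\<in>P. ennreal \<bar>\<mu> B\<bar>)"

text \<open>A finite signed Borel measure is a countably additive real-valued function on the Borel
  sets. Signed measures are made canonical by the value 0 on all other sets. The empty set gets
  measure 0 by countable additivity, since a constant series converges only if it vanishes.\<close>

definition signed_borel_measure :: "'a topology \<Rightarrow> ('a set \<Rightarrow> real) \<Rightarrow> bool" where
  "signed_borel_measure K \<mu> \<longleftrightarrow>
     (\<forall>A. A \<notin> borel_sets K \<longrightarrow> \<mu> A = 0) \<and>
     (\<forall>A::nat \<Rightarrow> 'a set. range A \<subseteq> borel_sets K \<and> disjoint_family A \<longrightarrow>
        (\<lambda>n. \<mu> (A n)) sums \<mu> (\<Union>n. A n))"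

definition regular_measure :: "'a topology \<Rightarrow> ('a set \<Rightarrow> real) \<Rightarrow> bool" where
  "regular_measure K \<mu> \<longleftrightarrow>
     (\<forall>A\<in>borel_sets K. \<forall>\<epsilon>>0. \<exists>C U. compactin K C \<and> openin K U \<and> C \<subseteq> A \<and> A \<subseteq> U \<and>
        total_variation K \<mu> (U - C) < ennreal \<epsilon>)"

definition signed_measures :: "'a topology \<Rightarrow> ('a set \<Rightarrow> real) set" where
  "signed_measures K = {\<mu>. signed_borel_measure K \<mu> \<and> regular_measure K \<mu>}"

definition prob_measures :: "'a topology \<Rightarrow> ('a set \<Rightarrow> real) set" where
  "prob_measures K =
     {\<mu> \<in> signed_measures K. (\<forall>A\<in>borel_sets K. 0 \<le> \<mu> A) \<and> \<mu> (topspace K) = 1}"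

definition to_measure :: "'a topology \<Rightarrow> ('a set \<Rightarrow> real) \<Rightarrow> 'a measure" where
  "to_measure K \<mu> = measure_of (topspace K) (borel_sets K) (\<lambda>B. ennreal (\<mu> B))"

lemma sigma_algebra_borel_sets: "sigma_algebra (topspace K) (borel_sets K)"
  unfolding borel_sets_def by (rule sigma_algebra_sigma_sets) (auto dest: openin_subset)

lemma sets_to_measure [simp]: "sets (to_measure K \<mu>) = borel_sets K"
  and space_to_measure [simp]: "space (to_measure K \<mu>) = topspace K"
  unfolding to_measure_def
  by (simp_all add: sigma_algebra.sets_measure_of_eq[OF sigma_algebra_borel_sets]
      sigma_algebra.space_measure_of_eq[OF sigma_algebra_borel_sets])

lemma emeasure_to_measure:
  assumes "\<mu> \<in> prob_measures K" "A \<in> borel_sets K"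
  shows "emeasure (to_measure K \<mu>) A = ennreal (\<mu> A)"
proof -
  interpret sigma_algebra "topspace K" "borel_sets K" by (rule sigma_algebra_borel_sets)
  have sums: "(\<lambda>n. \<mu> (F n)) sums \<mu> (\<Union>n. F n)"
    if "range F \<subseteq> borel_sets K" "disjoint_family F" for F :: "nat \<Rightarrow> 'a set"
    using assms(1) that by (simp add: prob_measures_def signed_measures_def signed_borel_measure_def)
  have nonneg: "0 \<le> \<mu> B" if "B \<in> borel_sets K" for B
    using assms(1) that by (simp add: prob_measures_def)
  have "(\<lambda>n::nat. \<mu> {}) sums \<mu> {}"
    using sums[of "\<lambda>_. {}"] by (simp add: disjoint_family_on_def)
  then have "\<mu> {} = 0"
    using sums_summable summable_const_iff by blast
  moreover have "(\<Sum>n. ennreal (\<mu> (F n))) = ennreal (\<mu> (\<Union>n. F n))"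
    if F: "range F \<subseteq> borel_sets K" "disjoint_family F" for F :: "nat \<Rightarrow> 'a set"
  proof -
    have "(\<Union>n. F n) \<in> borel_sets K"
      using F(1) by (rule countable_nat_UN)
    moreover have "F n \<in> borel_sets K" for n
      using F(1) by auto
    ultimately have "(\<lambda>n. ennreal (\<mu> (F n))) sums ennreal (\<mu> (\<Union>n. F n))"
      using sums[OF F] nonneg by (subst sums_ennreal) auto
    then show ?thesis
      by (rule sums_unique[symmetric])
  qed
  ultimately have "measure_space (topspace K) (borel_sets K) (\<lambda>B. ennreal (\<mu> B))"
    by (auto simp: measure_space_def positive_def countably_additive_def sigma_algebra_borel_sets)
  then show ?thesis
    unfolding to_measure_def
    using emeasure_measure_of_sigma assms(2) sigma_algebra_borel_sets
    by (metis (no_types, lifting) measure_space_def)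
qed

definition measurable_wrt :: "'a topology \<Rightarrow> ('a set \<Rightarrow> real) \<Rightarrow> 'a set \<Rightarrow> bool" where
  "measurable_wrt K \<mu> A \<longleftrightarrow> A \<in> sets (completion (to_measure K \<mu>))"

definition sigma_compactin :: "'a topology \<Rightarrow> 'a set \<Rightarrow> bool" where
  "sigma_compactin X S \<longleftrightarrow> (\<exists>C::nat \<Rightarrow> 'a set. (\<forall>n. compactin X (C n)) \<and> S = (\<Union>n. C n))"

definition M_R :: "'a topology \<Rightarrow> ((('a \<Rightarrow> real) \<Rightarrow> real) set \<Rightarrow> real) set" where
  "M_R X = {\<mu> \<in> signed_measures (stone_cech X). \<exists>S. sigma_compactin X S \<and>
     total_variation (stone_cech X) \<mu> (topspace (stone_cech X) - stone_cech_embed X ` S) = 0}"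

definition M_tau :: "'a topology \<Rightarrow> ((('a \<Rightarrow> real) \<Rightarrow> real) set \<Rightarrow> real) set" where
  "M_tau X = {\<mu> \<in> signed_measures (stone_cech X). \<forall>C. compactin (stone_cech X) C \<and>
     C \<subseteq> topspace (stone_cech X) - stone_cech_embed X ` topspace X \<longrightarrow>
     total_variation (stone_cech X) \<mu> C = 0}"

definition universally_tau_measurable :: "'a topology \<Rightarrow> bool" where
  "universally_tau_measurable X \<longleftrightarrow> M_tau X = M_R X"

end

theory Submission
  imports Defs
begin

text \<open>Let \<open>X\<close> be embedded in a compact Hausdorff space \<open>K\<close>; the cases of interest are
  \<open>K = \<beta>X\<close> and \<open>K = \<beta>Y\<close> with \<open>X \<subseteq> Y\<close>. It suffices to show that \<open>X\<close> is universally
  \<open>\<tau>\<close>-measurable iff it is \<open>\<mu>\<close>-measurable for all \<open>\<mu> \<in> P(K)\<close>.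

  If \<open>X\<close> is universally \<open>\<tau>\<close>-measurable and \<open>\<mu> \<in> P(K)\<close>, then \<open>\<lambda>(B) = \<mu>\<^sup>*(B \<inter> X)\<close> defines a
  Radon measure on \<open>\<beta>X\<close>. It vanishes on compact sets disjoint from \<open>X\<close>, so it is concentrated on a
  \<open>\<sigma>\<close>-compact \<open>S \<subseteq> X\<close>. Thus \<open>X - S\<close> has outer \<open>\<mu>\<close>-measure zero and \<open>X\<close> is \<open>\<mu>\<close>-measurable.

  Conversely, let \<open>\<mu> \<in> M\<^sub>\<tau>(X)\<close> and let \<open>h : \<beta>X \<rightarrow> K\<close> extend the embedding. The image of \<open>\<bar>\<mu>\<bar>\<close>
  under \<open>h\<close> vanishes on compact sets disjoint from the measurable set \<open>X\<close>, so by inner regularity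
  it is concentrated on a \<open>\<sigma>\<close>-compact \<open>S \<subseteq> X\<close>. Since \<open>h\<close> maps \<open>\<beta>X - X\<close> off \<open>X\<close>,
  \<open>\<mu>\<close> is concentrated on \<open>S\<close> as well.\<close>

section \<open>Borel sets\<close>

lemma openin_imp_borel_sets: "openin K U \<Longrightarrow> U \<in> borel_sets K"
  unfolding borel_sets_def by (simp add: sigma_sets.Basic)

lemma closedin_imp_borel_sets:
  assumes "closedin K C"
  shows "C \<in> borel_sets K"
proof -
  have "openin K (topspace K - C)"
    using assms by blast
  then have "topspace K - (topspace K - C) \<in> borel_sets K"
    unfolding borel_sets_def by (simp only: sigma_sets.Compl sigma_sets.Basic mem_Collect_eq)
  then show ?thesis
    using closedin_subset[OF assms] by (simp add: double_diff)
qed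

lemma compactin_imp_borel_sets: "Hausdorff_space K \<Longrightarrow> compactin K C \<Longrightarrow> C \<in> borel_sets K"
  by (simp add: closedin_imp_borel_sets compactin_imp_closedin)

lemma borel_sets_Diff: "A \<in> borel_sets K \<Longrightarrow> B \<in> borel_sets K \<Longrightarrow> A - B \<in> borel_sets K"
  using ring_of_sets.Diff algebra.axioms(1) sigma_algebra.axioms(1) sigma_algebra_borel_sets
  by metis

lemma borel_sets_UN:
  assumes "\<And>n::nat. F n \<in> borel_sets K"
  shows "(\<Union>n. F n) \<in> borel_sets K"
  using assms unfolding borel_sets_def by (rule sigma_sets.Union)

lemma space_eq_topspace: "sets M = borel_sets K \<Longrightarrow> space M = topspace K"
  using sets_eq_imp_space_eq[of M "to_measure K \<mu>" for \<mu>] by simp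

lemma measurable_continuous_map:
  assumes M: "sets M = borel_sets K" and N: "sets N = borel_sets L" and h: "continuous_map K L h"
  shows "h \<in> measurable M N"
proof -
  have sp: "space M = topspace K" "space N = topspace L"
    by (rule space_eq_topspace[OF M], rule space_eq_topspace[OF N])
  have "{U. openin L U} \<subseteq> Pow (topspace L)"
    using openin_subset by blast
  moreover have "h \<in> space M \<rightarrow> topspace L"
    using h by (auto simp: sp continuous_map_def)
  moreover have "h -` U \<inter> space M \<in> sets M" if "openin L U" for U
  proof -
    have "h -` U \<inter> space M = {x \<in> topspace K. h x \<in> U}"
      by (auto simp: sp)
    then show ?thesis
      using openin_continuous_map_preimage[OF h that] by (simp add: M openin_imp_borel_sets)
  qed
  ultimately show ?thesis
    using N by (intro measurable_sigma_sets[where A="{U. openin L U}" and \<Omega>="topspace L"])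
      (auto simp: borel_sets_def)
qed

section \<open>The total variation as a measure\<close>

lemma signed_borel_measure_sums:
  fixes F :: "nat \<Rightarrow> 'a set"
  assumes "signed_borel_measure K \<mu>" "range F \<subseteq> borel_sets K" "disjoint_family F"
  shows "(\<lambda>n. \<mu> (F n)) sums \<mu> (\<Union>n. F n)"
proof -
  have "\<forall>A::nat \<Rightarrow> 'a set. range A \<subseteq> borel_sets K \<and> disjoint_family A \<longrightarrow>
        (\<lambda>n. \<mu> (A n)) sums \<mu> (\<Union>n. A n)"
    using assms(1) unfolding signed_borel_measure_def by (rule conjunct2)
  then show ?thesis
    by (rule allE[of _ F]) (use assms(2,3) in \<open>elim impE, intro conjI\<close>)
qed

lemma signed_borel_measure_empty:
  assumes "signed_borel_measure K \<mu>"
  shows "\<mu> {} = 0"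
proof -
  have "range (\<lambda>_::nat. {}) \<subseteq> borel_sets K" "disjoint_family (\<lambda>_::nat. {}::'a set)"
    by (simp_all add: openin_imp_borel_sets disjoint_family_on_def)
  then have "(\<lambda>n::nat. \<mu> {}) sums \<mu> (\<Union>n::nat. {})"
    by (rule signed_borel_measure_sums[OF assms])
  then have "(\<lambda>n::nat. \<mu> {}) sums \<mu> {}"
    by simp
  then show ?thesis
    using sums_summable summable_const_iff by blast
qed

lemma sum_le_total_variation:
  assumes "finite P" "P \<subseteq> borel_sets K" "disjoint P"
  shows "(\<Sum>B\<in>P. ennreal \<bar>\<mu> B\<bar>) \<le> total_variation K \<mu> (\<Union>P)"
  unfolding total_variation_def using assms by (intro SUP_upper) auto

lemma total_variation_leI:
  assumes "\<And>P. finite P \<Longrightarrow> P \<subseteq> borel_sets K \<Longrightarrow> disjoint P \<Longrightarrow> \<Union>P = A \<Longrightarrow>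
    (\<Sum>B\<in>P. ennreal \<bar>\<mu> B\<bar>) \<le> c"
  shows "total_variation K \<mu> A \<le> c"
  unfolding total_variation_def using assms by (intro SUP_least) auto

text \<open>A finite partition of a singleton has no members except the singleton and possibly the
  empty set. The resulting finiteness at points starts the compactness argument of
  \<open>finite_variation_measure\<close>.\<close>

lemma total_variation_singleton:
  assumes "signed_borel_measure K \<mu>"
  shows "total_variation K \<mu> {x} \<le> ennreal \<bar>\<mu> {x}\<bar>"
proof (rule total_variation_leI)
  fix P assume P: "finite P" "\<Union>P = {x}"
  then have "P \<subseteq> Pow {x}"
    by auto
  then have "P \<subseteq> {{}, {x}}"
    by auto
  then have "(\<Sum>B\<in>P. ennreal \<bar>\<mu> B\<bar>) \<le> (\<Sum>B\<in>{{}, {x}}. ennreal \<bar>\<mu> B\<bar>)"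
    by (intro sum_mono2) auto
  then show "(\<Sum>B\<in>P. ennreal \<bar>\<mu> B\<bar>) \<le> ennreal \<bar>\<mu> {x}\<bar>"
    by (simp add: signed_borel_measure_empty[OF assms])
qed

lemma total_variation_empty:
  assumes "signed_borel_measure K \<mu>"
  shows "total_variation K \<mu> {} = 0"
proof -
  have "(\<Sum>B\<in>P. ennreal \<bar>\<mu> B\<bar>) = 0" if "\<Union>P = {}" for P
    using that by (intro sum.neutral) (auto simp: signed_borel_measure_empty[OF assms])
  then have "total_variation K \<mu> {} \<le> 0"
    by (intro total_variation_leI) simp
  then show ?thesis
    by simp
qed

text \<open>A partition of \<open>A\<close> and one of \<open>B\<close> together partition the
  union; the two suprema are then taken one after the other.\<close>

lemma total_variation_superadditive:
  assumes \<mu>: "signed_borel_measure K \<mu>"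
    and A: "A \<in> borel_sets K" and B: "B \<in> borel_sets K" and disj: "A \<inter> B = {}"
  shows "total_variation K \<mu> A + total_variation K \<mu> B \<le> total_variation K \<mu> (A \<union> B)"
proof -
  let ?part = "\<lambda>A. {P. finite P \<and> P \<subseteq> borel_sets K \<and> disjoint P \<and> \<Union>P = A}"
  let ?s = "\<lambda>P. \<Sum>B\<in>P. ennreal \<bar>\<mu> B\<bar>"
  have sum: "?s P + ?s Q \<le> total_variation K \<mu> (A \<union> B)" if "P \<in> ?part A" "Q \<in> ?part B" for P Q
  proof -
    have P: "finite P" "P \<subseteq> borel_sets K" "disjoint P" "\<Union>P = A"
      and Q: "finite Q" "Q \<subseteq> borel_sets K" "disjoint Q" "\<Union>Q = B"
      using that by auto
    \<comment> \<open>Partitions may contain the empty set, so \<open>P\<close> and \<open>Q\<close>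
      may share it; the common part contributes 0.\<close>
    have "?s P + ?s Q = ?s (P \<union> Q) + ?s (P \<inter> Q)"
      by (rule sum.union_inter[symmetric, OF P(1) Q(1)])
    also have "?s (P \<inter> Q) = 0"
    proof (intro sum.neutral ballI)
      fix p assume "p \<in> P \<inter> Q"
      then have "p = {}"
        using P(4) Q(4) disj by auto
      then show "ennreal \<bar>\<mu> p\<bar> = 0"
        by (simp add: signed_borel_measure_empty[OF \<mu>])
    qed
    also have "?s (P \<union> Q) + 0 \<le> total_variation K \<mu> (\<Union>(P \<union> Q))"
    proof -
      have "disjoint (P \<union> Q)"
        using P(3,4) Q(3,4) disj by (intro disjoint_union) simp_all
      then show ?thesis
        using P(1,2) Q(1,2) sum_le_total_variation[of "P \<union> Q" K \<mu>] by (simp del: sum_ennreal)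
    qed
    also have "\<Union>(P \<union> Q) = A \<union> B"
      using P(4) Q(4) by simp
    finally show ?thesis .
  qed
  \<comment> \<open>The trivial partition makes the index sets nonempty, which allows a constant
    summand to be moved into or out of a supremum.\<close>
  have ne: "?part A \<noteq> {}" if "A \<in> borel_sets K" for A
  proof -
    have "{A} \<in> ?part A"
      using that by simp
    then show ?thesis
      by (metis empty_iff)
  qed
  have "?s P + total_variation K \<mu> B \<le> total_variation K \<mu> (A \<union> B)" if "P \<in> ?part A" for P
    unfolding total_variation_def[of K \<mu> B] ennreal_SUP_add_right[OF ne[OF B]]
    by (rule SUP_least, rule sum[OF that])
  then show ?thesis
    unfolding total_variation_def[of K \<mu> A] ennreal_SUP_add_left[OF ne[OF A], symmetric]
    by (intro SUP_least)
qed

lemma total_variation_mono: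
  assumes \<mu>: "signed_borel_measure K \<mu>"
    and A: "A \<in> borel_sets K" and B: "B \<in> borel_sets K" and sub: "A \<subseteq> B"
  shows "total_variation K \<mu> A \<le> total_variation K \<mu> B"
proof -
  interpret sigma_algebra "topspace K" "borel_sets K"
    by (rule sigma_algebra_borel_sets)
  have "total_variation K \<mu> A \<le> total_variation K \<mu> A + total_variation K \<mu> (B - A)"
    by simp
  also have "\<dots> \<le> total_variation K \<mu> (A \<union> (B - A))"
    using A B by (intro total_variation_superadditive \<mu>) auto
  also have "A \<union> (B - A) = B"
    using sub by auto
  finally show ?thesis .
qed

text \<open>Each member of a partition of the union is cut along the sets \<open>F n\<close>.
  Countable additivity of \<open>\<mu>\<close> bounds its value by those of the pieces, and for
  fixed \<open>n\<close> the pieces partition \<open>F n\<close>; interchanging the sums gives the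
  claim.\<close>

lemma total_variation_UN_le:
  fixes F :: "nat \<Rightarrow> 'a set"
  assumes \<mu>: "signed_borel_measure K \<mu>"
    and F: "range F \<subseteq> borel_sets K" "disjoint_family F"
  shows "total_variation K \<mu> (\<Union>n. F n) \<le> (\<Sum>n. total_variation K \<mu> (F n))"
proof (rule total_variation_leI)
  interpret sigma_algebra "topspace K" "borel_sets K"
    by (rule sigma_algebra_borel_sets)
  fix P assume P: "finite P" "P \<subseteq> borel_sets K" "disjoint P" "\<Union>P = (\<Union>n. F n)"
  have Fb: "F n \<in> borel_sets K" for n
    by (rule subsetD[OF F(1) rangeI])
  \<comment> \<open>If the series of absolute values diverges, its sum in \<open>ennreal\<close> is
    \<open>top\<close> and the bound is trivial. Otherwise it is the triangle inequality for
    series.\<close>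
  have le: "ennreal \<bar>\<mu> p\<bar> \<le> (\<Sum>n. ennreal \<bar>\<mu> (p \<inter> F n)\<bar>)" if p: "p \<in> P" for p
  proof (cases "summable (\<lambda>n. \<bar>\<mu> (p \<inter> F n)\<bar>)")
    case True
    have ran: "range (\<lambda>n. p \<inter> F n) \<subseteq> borel_sets K"
    proof (rule image_subsetI)
      show "p \<inter> F n \<in> borel_sets K" for n
        by (intro Int Fb subsetD[OF P(2) p])
    qed
    have disj: "disjoint_family (\<lambda>n. p \<inter> F n)"
      unfolding disjoint_family_on_def using disjoint_family_onD[OF F(2)] by auto
    have "(\<lambda>n. \<mu> (p \<inter> F n)) sums \<mu> (\<Union>n. p \<inter> F n)"
      by (rule signed_borel_measure_sums[OF \<mu> ran disj])
    moreover have "(\<Union>n. p \<inter> F n) = p"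
    proof -
      have "p \<subseteq> (\<Union>n. F n)"
        unfolding P(4)[symmetric] by (rule Union_upper[OF p])
      then show ?thesis
        by blast
    qed
    ultimately have "\<mu> p = (\<Sum>n. \<mu> (p \<inter> F n))"
      by (simp add: sums_unique)
    then have "\<bar>\<mu> p\<bar> \<le> (\<Sum>n. \<bar>\<mu> (p \<inter> F n)\<bar>)"
      by (metis summable_rabs[OF True])
    then show ?thesis
      using True by (simp add: suminf_ennreal2 ennreal_leI)
  next
    case False
    have "(\<Sum>n. ennreal \<bar>\<mu> (p \<inter> F n)\<bar>) = top"
      using summable_suminf_not_top[of "\<lambda>n. \<bar>\<mu> (p \<inter> F n)\<bar>", OF abs_ge_zero] False by argo
    then show ?thesis
      by simp
  qed
  have part: "(\<Sum>p\<in>P. ennreal \<bar>\<mu> (p \<inter> F n)\<bar>) \<le> total_variation K \<mu> (F n)" for n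
  proof -
    have "(\<Sum>B\<in>(\<lambda>p. p \<inter> F n) ` P. ennreal \<bar>\<mu> B\<bar>) =
        (\<Sum>p\<in>P. ((\<lambda>B. ennreal \<bar>\<mu> B\<bar>) \<circ> (\<lambda>p. p \<inter> F n)) p)"
    \<comment> \<open>Distinct members of \<open>P\<close> are disjoint, so they can have the same
      trace on \<open>F n\<close> only if that trace is empty; identified pieces contribute
      0.\<close>
    proof (rule sum.reindex_nontrivial[OF P(1)])
      fix p q assume "p \<in> P" "q \<in> P" "p \<noteq> q" and eq: "p \<inter> F n = q \<inter> F n"
      then have "p \<inter> q = {}"
        by (intro disjointD[OF P(3)])
      then have "p \<inter> F n = {}"
        using eq by blast
      then show "ennreal \<bar>\<mu> (p \<inter> F n)\<bar> = 0"
        by (simp add: signed_borel_measure_empty[OF \<mu>])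
    qed
    then have "(\<Sum>p\<in>P. ennreal \<bar>\<mu> (p \<inter> F n)\<bar>) = (\<Sum>B\<in>(\<lambda>p. p \<inter> F n) ` P. ennreal \<bar>\<mu> B\<bar>)"
      by (simp only: o_apply)
    also have "\<dots> \<le> total_variation K \<mu> (\<Union>((\<lambda>p. p \<inter> F n) ` P))"
    proof (rule sum_le_total_variation)
      show "(\<lambda>p. p \<inter> F n) ` P \<subseteq> borel_sets K"
        using P(2) by (intro image_subsetI Int Fb) blast
      show "disjoint ((\<lambda>p. p \<inter> F n) ` P)"
      proof (rule disjointI)
        fix a b assume ab: "a \<in> (\<lambda>p. p \<inter> F n) ` P" "b \<in> (\<lambda>p. p \<inter> F n) ` P" "a \<noteq> b"
        then obtain p q where pq: "p \<in> P" "q \<in> P" "a = p \<inter> F n" "b = q \<inter> F n"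
          by (elim imageE)
        then have "p \<inter> q = {}"
          using ab(3) by (intro disjointD[OF P(3)]) auto
        then show "a \<inter> b = {}"
          using pq(3,4) by auto
      qed
    qed (use P(1) in simp)
    also have "\<Union>((\<lambda>p. p \<inter> F n) ` P) = \<Union>P \<inter> F n"
      by blast
    also have "\<dots> = F n"
      unfolding P(4) by blast
    finally show ?thesis .
  qed
  have "(\<Sum>p\<in>P. ennreal \<bar>\<mu> p\<bar>) \<le> (\<Sum>p\<in>P. \<Sum>n. ennreal \<bar>\<mu> (p \<inter> F n)\<bar>)"
    by (intro sum_mono le)
  also have "\<dots> = (\<Sum>n. \<Sum>p\<in>P. ennreal \<bar>\<mu> (p \<inter> F n)\<bar>)"
    by (intro suminf_sum[symmetric]) simp
  also have "\<dots> \<le> (\<Sum>n. total_variation K \<mu> (F n))"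
    by (intro suminf_le part) auto
  finally show "(\<Sum>p\<in>P. ennreal \<bar>\<mu> p\<bar>) \<le> (\<Sum>n. total_variation K \<mu> (F n))" .
qed

text \<open>Superadditivity and monotonicity bound the partial sums, and
  \<open>total_variation_UN_le\<close> gives the converse. Infinite values are still possible at
  this stage; regularity excludes them later.\<close>

lemma countably_additive_total_variation:
  assumes \<mu>: "signed_borel_measure K \<mu>"
  shows "countably_additive (borel_sets K) (total_variation K \<mu>)"
proof (rule countably_additiveI)
  interpret sigma_algebra "topspace K" "borel_sets K"
    by (rule sigma_algebra_borel_sets)
  fix F :: "nat \<Rightarrow> 'a set"
  assume F: "range F \<subseteq> borel_sets K" "disjoint_family F" "(\<Union>n. F n) \<in> borel_sets K"
  have "(\<Sum>i<n. total_variation K \<mu> (F i)) \<le> total_variation K \<mu> (\<Union>i<n. F i)" for n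
  proof (induction n)
    case (Suc n)
    have "(\<Sum>i<Suc n. total_variation K \<mu> (F i))
        \<le> total_variation K \<mu> (\<Union>i<n. F i) + total_variation K \<mu> (F n)"
      using Suc by (simp add: add_right_mono)
    also have "\<dots> \<le> total_variation K \<mu> ((\<Union>i<n. F i) \<union> F n)"
    proof (rule total_variation_superadditive[OF \<mu>])
      show "(\<Union>i<n. F i) \<inter> F n = {}"
      proof -
        have "F i \<inter> F n = {}" if "i < n" for i
          using that by (intro disjoint_family_onD[OF F(2)]) auto
        then show ?thesis
          by blast
      qed
    qed (use F(1) in auto)
    also have "(\<Union>i<n. F i) \<union> F n = (\<Union>i<Suc n. F i)"
      by (auto simp: less_Suc_eq)
    finally show ?case .
  qed (simp add: total_variation_empty[OF \<mu>])
  also have "total_variation K \<mu> (\<Union>i<n. F i) \<le> total_variation K \<mu> (\<Union>n. F n)" for n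
    using F by (intro total_variation_mono \<mu>) auto
  finally have "(\<Sum>n. total_variation K \<mu> (F n)) \<le> total_variation K \<mu> (\<Union>n. F n)"
    by (intro suminf_le_const) auto
  with total_variation_UN_le[OF \<mu> F(1,2)]
  show "(\<Sum>n. total_variation K \<mu> (F n)) = total_variation K \<mu> (\<Union>n. F n)"
    by (rule antisym[rotated])
qed

definition variation_measure :: "'a topology \<Rightarrow> ('a set \<Rightarrow> real) \<Rightarrow> 'a measure" where
  "variation_measure K \<mu> = measure_of (topspace K) (borel_sets K) (total_variation K \<mu>)"

lemma sets_variation_measure [simp]: "sets (variation_measure K \<mu>) = borel_sets K"
  by (simp add: variation_measure_def sigma_algebra.sets_measure_of_eq[OF sigma_algebra_borel_sets])

lemma emeasure_variation_measure:
  assumes "signed_borel_measure K \<mu>" "A \<in> borel_sets K"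
  shows "emeasure (variation_measure K \<mu>) A = total_variation K \<mu> A"
  unfolding variation_measure_def
  using assms sigma_algebra_borel_sets countably_additive_total_variation
  by (intro emeasure_measure_of_sigma) (auto simp: positive_def total_variation_empty)

section \<open>Radon measures\<close>

text \<open>Only inner approximation is built in: on a compact Hausdorff space outer approximation
  follows through complements, see \<open>radon_measure_approx\<close>.\<close>

definition radon_measure :: "'a topology \<Rightarrow> 'a measure \<Rightarrow> bool" where
  "radon_measure K M \<longleftrightarrow> sets M = borel_sets K \<and> finite_measure M \<and>
     (\<forall>A\<in>borel_sets K. \<forall>\<epsilon>>0. \<exists>C. compactin K C \<and> C \<subseteq> A \<and> emeasure M (A - C) < ennreal \<epsilon>)"

lemma radon_measureD:
  assumes "radon_measure K M"
  shows "sets M = borel_sets K" "space M = topspace K" "finite_measure M"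
  using assms space_eq_topspace by (auto simp: radon_measure_def)

lemma radon_measureE:
  assumes "radon_measure K M" "A \<in> borel_sets K" "0 < \<epsilon>"
  obtains C where "compactin K C" "C \<subseteq> A" "emeasure M (A - C) < ennreal \<epsilon>"
  using assms unfolding radon_measure_def by meson

text \<open>A singleton has finite variation, so by outer regularity it has a neighbourhood of finite
  variation; compactness makes the total variation finite.\<close>

lemma finite_variation_measure:
  assumes K: "compact_space K" "Hausdorff_space K" and \<mu>: "\<mu> \<in> signed_measures K"
  shows "finite_measure (variation_measure K \<mu>)"
proof -
  let ?V = "variation_measure K \<mu>"
  have s: "signed_borel_measure K \<mu>" and r: "regular_measure K \<mu>"
    using \<mu> by (auto simp: signed_measures_def)
  have nbhd: "\<exists>U. openin K U \<and> x \<in> U \<and> emeasure ?V U < \<infinity>" if x: "x \<in> topspace K" for x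
  proof -
    have bx: "{x} \<in> borel_sets K"
      using K x by (simp add: closedin_imp_borel_sets closedin_Hausdorff_singleton)
    then obtain C U where CU: "compactin K C" "openin K U" "C \<subseteq> {x}" "{x} \<subseteq> U"
        "total_variation K \<mu> (U - C) < ennreal 1"
      using r unfolding regular_measure_def by (meson zero_less_one)
    have b: "U \<in> sets ?V" "C \<in> sets ?V" "{x} \<in> sets ?V"
      using CU K bx by (auto intro: openin_imp_borel_sets compactin_imp_borel_sets)
    have "emeasure ?V {x} \<le> ennreal \<bar>\<mu> {x}\<bar>"
      using bx s by (simp add: emeasure_variation_measure total_variation_singleton)
    then have fx: "emeasure ?V {x} < \<infinity>"
      using ennreal_less_top le_less_trans by fastforce
    have fU: "emeasure ?V (U - C) < \<infinity>"
    proof -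
      have "emeasure ?V (U - C) = total_variation K \<mu> (U - C)"
        using b by (intro emeasure_variation_measure s borel_sets_Diff) simp_all
      also have "\<dots> < \<infinity>"
        using less_trans[OF CU(5) ennreal_less_top] by simp
      finally show ?thesis .
    qed
    \<comment> \<open>As \<open>C\<close> is empty or the singleton of \<open>x\<close>, adding
      \<open>x\<close> to \<open>U - C\<close> gives back all of \<open>U\<close>.\<close>
    have "emeasure ?V U \<le> emeasure ?V ((U - C) \<union> {x})"
      using CU(3,4) by (intro emeasure_mono sets.Un sets.Diff b) blast
    also have "\<dots> \<le> emeasure ?V (U - C) + emeasure ?V {x}"
      by (intro emeasure_subadditive sets.Diff b)
    also have "\<dots> < \<infinity>"
      using fx fU by simp
    finally show ?thesis
      using CU by blast
  qed
  define \<U> where "\<U> = {U. openin K U \<and> emeasure ?V U < \<infinity>}"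
  have "topspace K \<subseteq> \<Union>\<U>" "\<And>U. U \<in> \<U> \<Longrightarrow> openin K U"
    using nbhd by (auto simp: \<U>_def)
  then obtain \<F> where \<F>: "finite \<F>" "\<F> \<subseteq> \<U>" "topspace K \<subseteq> \<Union>\<F>"
    using K(1) unfolding compact_space_alt by meson
  have "emeasure ?V (topspace K) \<le> emeasure ?V (\<Union>U\<in>\<F>. U)"
    using \<F> by (intro emeasure_mono sets.finite_UN) (auto simp: \<U>_def openin_imp_borel_sets)
  also have "\<dots> \<le> (\<Sum>U\<in>\<F>. emeasure ?V U)"
    using \<F> by (intro emeasure_subadditive_finite) (auto simp: \<U>_def openin_imp_borel_sets)
  also have "\<dots> < \<infinity>"
    using \<F> by (auto simp: \<U>_def)
  finally show ?thesis
    by (intro finite_measureI) (simp add: space_eq_topspace[OF sets_variation_measure])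
qed

lemma radon_variation_measure:
  assumes K: "compact_space K" "Hausdorff_space K" and \<mu>: "\<mu> \<in> signed_measures K"
  shows "radon_measure K (variation_measure K \<mu>)"
  unfolding radon_measure_def
proof (intro conjI ballI allI impI)
  let ?V = "variation_measure K \<mu>"
  have s: "signed_borel_measure K \<mu>" and r: "regular_measure K \<mu>"
    using \<mu> by (auto simp: signed_measures_def)
  fix A and \<epsilon> :: real assume A: "A \<in> borel_sets K" and "0 < \<epsilon>"
  then obtain C U where CU: "compactin K C" "openin K U" "C \<subseteq> A" "A \<subseteq> U"
        "total_variation K \<mu> (U - C) < ennreal \<epsilon>"
    using r unfolding regular_measure_def by meson
  have b: "U \<in> sets ?V" "C \<in> sets ?V"
    using CU K by (auto intro: openin_imp_borel_sets compactin_imp_borel_sets)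
  have "emeasure ?V (A - C) \<le> emeasure ?V (U - C)"
    using CU(3,4) by (intro emeasure_mono sets.Diff b) blast
  also have "\<dots> < ennreal \<epsilon>"
    using CU(5) b s by (simp add: emeasure_variation_measure borel_sets_Diff)
  finally show "\<exists>C. compactin K C \<and> C \<subseteq> A \<and> emeasure ?V (A - C) < ennreal \<epsilon>"
    using CU by blast
qed (use finite_variation_measure[OF assms] in auto)

section \<open>Radon measures as signed measures, and normalization to probability measures\<close>

lemma total_variation_measure:
  assumes M: "sets M = borel_sets K" "finite_measure M" and A: "A \<in> borel_sets K"
  shows "total_variation K (measure M) A = emeasure M A"
proof (rule antisym)
  interpret finite_measure M by fact
  show "total_variation K (measure M) A \<le> emeasure M A"
  proof (rule total_variation_leI)
    fix P assume P: "finite P" "P \<subseteq> borel_sets K" "disjoint P" "\<Union>P = A"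
    have "(\<Sum>B\<in>P. ennreal \<bar>measure M B\<bar>) = (\<Sum>B\<in>P. emeasure M B)"
      by (simp add: emeasure_eq_measure)
    also have "\<dots> = emeasure M (\<Union>B\<in>P. B)"
      using P M by (intro sum_emeasure) (auto simp: disjoint_family_on_def dest: disjointD)
    finally show "(\<Sum>B\<in>P. ennreal \<bar>measure M B\<bar>) \<le> emeasure M A"
      using P(4) by simp
  qed
  show "emeasure M A \<le> total_variation K (measure M) A"
    using sum_le_total_variation[of "{A}" K "measure M"] A by (simp add: emeasure_eq_measure)
qed

text \<open>Compact sets exhaust \<open>A\<close> and its complement up to \<epsilon>/2 each. The
  complement of the second compact set is the open set around \<open>A\<close>.\<close>

lemma radon_measure_approx:
  assumes K: "compact_space K" "Hausdorff_space K" and M: "radon_measure K M"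
    and A: "A \<in> borel_sets K" and \<epsilon>: "0 < (\<epsilon>::real)"
  shows "\<exists>C U. compactin K C \<and> openin K U \<and> C \<subseteq> A \<and> A \<subseteq> U \<and> emeasure M (U - C) < ennreal \<epsilon>"
proof -
  note MD = radon_measureD[OF M]
  obtain C where C: "compactin K C" "C \<subseteq> A" "emeasure M (A - C) < ennreal (\<epsilon>/2)"
    using radon_measureE[OF M A half_gt_zero[OF \<epsilon>]] .
  have "topspace K - A \<in> borel_sets K"
    by (intro borel_sets_Diff openin_imp_borel_sets openin_topspace A)
  then obtain D where D: "compactin K D" "D \<subseteq> topspace K - A"
      "emeasure M ((topspace K - A) - D) < ennreal (\<epsilon>/2)"
    by (rule radon_measureE[OF M _ half_gt_zero[OF \<epsilon>]])
  let ?U = "topspace K - D"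
  have AK: "A \<subseteq> topspace K"
    using A sets.sets_into_space[of A M] by (simp add: MD)
  have U: "openin K ?U"
    using D K by (simp add: compactin_imp_closedin openin_diff)
  have b: "A \<in> sets M" "C \<in> sets M" "D \<in> sets M" "topspace K \<in> sets M"
    unfolding MD(1) by (intro A openin_imp_borel_sets compactin_imp_borel_sets K C D openin_topspace)+
  have "emeasure M (?U - C) \<le> emeasure M ((A - C) \<union> ((topspace K - A) - D))"
    by (intro emeasure_mono sets.Un sets.Diff b) blast
  also have "\<dots> \<le> emeasure M (A - C) + emeasure M ((topspace K - A) - D)"
    by (intro emeasure_subadditive sets.Diff b)
  also have "\<dots> < ennreal (\<epsilon>/2) + ennreal (\<epsilon>/2)"
    by (intro add_strict_mono C D)
  also have "\<dots> = ennreal \<epsilon>"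
    using \<epsilon> by (simp flip: ennreal_plus)
  finally show ?thesis
    using C(1,2) D(2) U AK by (intro exI[of _ C] exI[of _ ?U]) blast
qed

lemma measure_in_signed_measures:
  assumes K: "compact_space K" "Hausdorff_space K" and M: "radon_measure K M"
  shows "measure M \<in> signed_measures K"
proof -
  note MD = radon_measureD[OF M]
  interpret finite_measure M by (rule MD)
  \<comment> \<open>\<open>measure\<close> is 0 outside \<open>sets M\<close>, in agreement with the
    normalization of signed measures.\<close>
  have "signed_borel_measure K (measure M)"
    unfolding signed_borel_measure_def MD(1)[symmetric]
    by (intro conjI allI impI) (simp_all add: measure_notin_sets finite_measure_UNION)
  moreover have "regular_measure K (measure M)"
    unfolding regular_measure_def
  proof (intro ballI allI impI)
    fix A and \<epsilon> :: real assume A: "A \<in> borel_sets K" "0 < \<epsilon>"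
    then obtain C U where CU: "compactin K C" "openin K U" "C \<subseteq> A" "A \<subseteq> U"
        "emeasure M (U - C) < ennreal \<epsilon>"
      using radon_measure_approx[OF assms A] by (elim exE conjE)
    have "U - C \<in> borel_sets K"
      by (intro borel_sets_Diff openin_imp_borel_sets compactin_imp_borel_sets CU K)
    then have "total_variation K (measure M) (U - C) = emeasure M (U - C)"
      using MD by (intro total_variation_measure)
    then show "\<exists>C U. compactin K C \<and> openin K U \<and> C \<subseteq> A \<and> A \<subseteq> U \<and>
        total_variation K (measure M) (U - C) < ennreal \<epsilon>"
      using CU by (intro exI[of _ C] exI[of _ U]) simp
  qed
  ultimately show ?thesis
    by (simp add: signed_measures_def)
qed

text \<open>Total variation involves values on Borel sets only, and for a positive measure it
  returns the measure itself. Regularity thereby carries over to \<open>to_measure\<close>, whose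
  completion defines measurability.\<close>

lemma variation_measure_prob:
  assumes "\<mu> \<in> prob_measures K"
  shows "variation_measure K \<mu> = to_measure K \<mu>" (is "?V = ?M")
proof (rule measure_eqI)
  have s: "signed_borel_measure K \<mu>"
    using assms by (simp add: prob_measures_def signed_measures_def)
  fix A assume A: "A \<in> sets ?V"
  have mu: "\<mu> B = measure ?M B" if "B \<in> borel_sets K" for B
    using assms that by (simp add: measure_def emeasure_to_measure prob_measures_def)
  have "finite_measure ?M"
    using assms by (intro finite_measureI) (simp add: emeasure_to_measure openin_imp_borel_sets)
  then have "total_variation K (measure ?M) A = emeasure ?M A"
    using A by (simp add: total_variation_measure)
  moreover have "total_variation K (measure ?M) A = total_variation K \<mu> A"
    unfolding total_variation_def
    by (intro SUP_cong refl sum.cong) (auto simp: mu)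
  ultimately show "emeasure ?V A = emeasure ?M A"
    using A s by (simp add: emeasure_variation_measure)
qed simp

lemma radon_to_measure:
  assumes "compact_space K" "Hausdorff_space K" "\<mu> \<in> prob_measures K"
  shows "radon_measure K (to_measure K \<mu>)"
  using radon_variation_measure[of K \<mu>] variation_measure_prob[of \<mu> K] assms
  by (simp add: prob_measures_def)

lemma to_measure_measure:
  assumes "measure M \<in> prob_measures K" "finite_measure M" "sets M = borel_sets K"
  shows "to_measure K (measure M) = M"
  using assms by (intro measure_eqI) (auto simp: emeasure_to_measure finite_measure.emeasure_eq_measure)

text \<open>Extends measurability from probability measures to all Radon measures: division by the
  total mass changes neither the Borel sets nor the null sets, hence not the completion.\<close>

lemma completion_if_measurable_wrt:
  assumes K: "compact_space K" "Hausdorff_space K" and M: "radon_measure K M"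
    and A: "A \<subseteq> topspace K" "\<And>\<mu>. \<mu> \<in> prob_measures K \<Longrightarrow> measurable_wrt K \<mu> A"
  shows "A \<in> sets (completion M)"
proof -
  note MD = radon_measureD[OF M]
  interpret finite_measure M by (rule MD)
  let ?c = "measure M (space M)"
  show ?thesis
  proof (cases "?c = 0")
    \<comment> \<open>The zero measure cannot be normalized, but its completion contains every
      subset of the space.\<close>
    case True
    then have "space M \<in> null_sets M"
      by (auto simp: null_sets_def emeasure_eq_measure)
    then show ?thesis
      using A(1) MD null_sets_completion by metis
  next
    case False
    then have c: "0 < ?c"
      by (simp add: zero_less_measure_iff)
    define N where "N = scale_measure (ennreal (1/?c)) M"
    have em: "emeasure N B = ennreal (measure M B / ?c)" for B
      using c by (simp add: N_def emeasure_eq_measure flip: ennreal_mult)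
    have "radon_measure K N"
      unfolding radon_measure_def
    proof (intro conjI ballI allI impI)
      show "sets N = borel_sets K" by (simp add: N_def MD)
      show "finite_measure N"
        by (intro finite_measureI) (simp add: em)
      fix B and \<epsilon> :: real assume B: "B \<in> borel_sets K" "0 < \<epsilon>"
      then have "0 < \<epsilon> * ?c" using c by simp
      then obtain C where "compactin K C" "C \<subseteq> B" "emeasure M (B - C) < ennreal (\<epsilon> * ?c)"
        by (rule radon_measureE[OF M B(1)])
      then show "\<exists>C. compactin K C \<and> C \<subseteq> B \<and> emeasure N (B - C) < ennreal \<epsilon>"
        using c by (intro exI[of _ C]) (auto simp: em emeasure_eq_measure ennreal_less_iff field_simps)
    qed
    note N = this radon_measureD[OF this]
    have "measure N (topspace K) = 1"
      using c by (simp add: measure_def[of N] em MD)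
    then have p: "measure N \<in> prob_measures K"
      using N measure_in_signed_measures[OF K] by (simp add: prob_measures_def)
    have "A \<in> sets (completion N)"
      using A(2)[OF p] to_measure_measure[OF p] N by (simp add: measurable_wrt_def)
    moreover have "null_sets N = null_sets M"
      using c by (auto simp: null_sets_def N_def em[unfolded N_def] emeasure_eq_measure)
    ultimately show ?thesis
      by (simp add: sets_completion N_def)
  qed
qed

section \<open>Exhaustion by compact sets; construction and images of Radon measures\<close>

lemma radon_measure_sigma_compact:
  assumes K: "Hausdorff_space K" and M: "radon_measure K M" and A: "A \<in> borel_sets K"
  shows "\<exists>C::nat \<Rightarrow> 'a set. (\<forall>n. compactin K (C n) \<and> C n \<subseteq> A) \<and> emeasure M (A - (\<Union>n. C n)) = 0"
proof -
  note MD = radon_measureD[OF M]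
  have "\<exists>C. compactin K C \<and> C \<subseteq> A \<and> emeasure M (A - C) < ennreal (inverse (Suc n))" for n
    by (rule radon_measureE[OF M A, of "inverse (Suc n)"]) auto
  then obtain C where C: "\<And>n. compactin K (C n)" "\<And>n. C n \<subseteq> A"
      "\<And>n. emeasure M (A - C n) < ennreal (inverse (Suc n))"
    by metis
  have "emeasure M (A - (\<Union>n. C n)) \<le> ennreal (inverse (Suc n))" for n
  proof -
    have "emeasure M (A - (\<Union>n. C n)) \<le> emeasure M (A - C n)"
      by (intro emeasure_mono, blast, unfold MD(1),
          intro borel_sets_Diff A compactin_imp_borel_sets[OF K C(1)])
    then show ?thesis
      using C(3)[of n] by simp
  qed
  moreover have "(\<lambda>n. ennreal (inverse (Suc n))) \<longlonglongrightarrow> ennreal 0"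
    by (intro tendsto_ennrealI LIMSEQ_inverse_real_of_nat)
  ultimately have "emeasure M (A - (\<Union>n. C n)) \<le> ennreal 0"
    by (intro LIMSEQ_le_const) auto
  then show ?thesis
    using C by auto
qed

text \<open>The sets that can be approximated by closed sets from inside and by open sets from
  outside form a \<open>\<sigma>\<close>-algebra.\<close>

lemma radon_measureI:
  assumes K: "compact_space K" and M: "sets M = borel_sets K" "finite_measure M"
    and inner: "\<And>U \<epsilon>::real. openin K U \<Longrightarrow> 0 < \<epsilon> \<Longrightarrow>
      \<exists>C. closedin K C \<and> C \<subseteq> U \<and> emeasure M (U - C) < ennreal \<epsilon>"
  shows "radon_measure K M"
proof -
  interpret finite_measure M by fact
  note op = openin_imp_borel_sets[of K, folded M(1)]
  note cl = closedin_imp_borel_sets[of K, folded M(1)]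
  have approx: "\<exists>C U. closedin K C \<and> openin K U \<and> C \<subseteq> A \<and> A \<subseteq> U \<and> emeasure M (U - C) < ennreal \<epsilon>"
    if "A \<in> sigma_sets (topspace K) {U. openin K U}" "0 < \<epsilon>" for A and \<epsilon> :: real
    using that
  proof (induction A arbitrary: \<epsilon>)
    case (Basic U)
    then have "openin K U"
      by simp
    with inner[OF this Basic.prems] show ?case
      by auto
  next
    case Empty
    then show ?case
      by (intro exI[of _ "{}"]) simp
  next
    case (Compl A)
    obtain C U where CU: "closedin K C" "openin K U" "C \<subseteq> A" "A \<subseteq> U" "emeasure M (U - C) < ennreal \<epsilon>"
      using Compl.IH[OF Compl.prems] by (elim exE conjE)
    \<comment> \<open>Complements exchange the inner closed set and the outer open set and keep the
      gap; this is why the induction carries both.\<close>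
    have "(topspace K - C) - (topspace K - U) = U - C"
      using openin_subset[OF CU(2)] by blast
    then show ?case
      using CU by (intro exI[of _ "topspace K - U"] exI[of _ "topspace K - C"])
        (auto simp: closedin_diff openin_diff)
  next
    case (Union A)
    \<comment> \<open>The errors add up to \<epsilon>/2, since comparing the series gives only a
      weak inequality and the final bound is strict.\<close>
    define d :: "nat \<Rightarrow> real" where "d n = \<epsilon>/2 * (1/2) ^ Suc n" for n
    have d: "0 < d n" for n
      using Union.prems by (simp add: d_def)
    have "\<exists>C U. closedin K C \<and> openin K U \<and> C \<subseteq> A n \<and> A n \<subseteq> U \<and> emeasure M (U - C) < ennreal (d n)" for n
      by (rule Union.IH[OF d])
    then obtain C U where CU: "\<And>n. closedin K (C n)" "\<And>n. openin K (U n)" "\<And>n. C n \<subseteq> A n"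
        "\<And>n. A n \<subseteq> U n" "\<And>n. emeasure M (U n - C n) < ennreal (d n)"
      by metis
    let ?U = "\<Union>n. U n"
    have U: "openin K ?U"
      using CU(2) by (intro openin_Union) blast
    have Cm: "(\<Union>n. C n) \<in> sets M"
      using cl[OF CU(1)] by (intro sets.countable_UN) blast
    have "d sums (\<epsilon>/2 * 1)"
      unfolding d_def by (intro sums_mult power_half_series)
    then have sumd: "(\<Sum>n. ennreal (d n)) = ennreal (\<epsilon>/2)"
      using d by (subst suminf_ennreal2) (auto simp: less_imp_le sums_iff)
    have mC: "U n - C n \<in> sets M" for n
      by (intro sets.Diff op cl CU)
    have "emeasure M (?U - (\<Union>n. C n)) \<le> emeasure M (\<Union>n. U n - C n)"
    proof (rule emeasure_mono)
      show "(\<Union>n. U n - C n) \<in> sets M"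
        using mC by (intro sets.countable_UN) blast
    qed blast
    also have "\<dots> \<le> (\<Sum>n. emeasure M (U n - C n))"
      by (rule emeasure_subadditive_countably) (use mC in blast)
    also have "\<dots> \<le> (\<Sum>n. ennreal (d n))"
      by (intro suminf_le less_imp_le CU) auto
    also have "\<dots> < ennreal \<epsilon>"
      using Union.prems by (simp add: sumd ennreal_less_iff)
    finally have less: "emeasure M (?U - (\<Union>n. C n)) < ennreal \<epsilon>" .
    \<comment> \<open>The union of all \<open>C n\<close> need not be closed. Finite unions are, and
      continuity from above of the finite measure \<open>M\<close> shows that one of them
      suffices.\<close>
    let ?D = "\<lambda>N. \<Union>n\<le>N. C n"
    have D: "closedin K (?D N)" for N
      using CU(1) by (intro closedin_Union) auto
    have "(\<lambda>N. emeasure M (?U - ?D N)) \<longlonglongrightarrow> emeasure M (\<Inter>N. ?U - ?D N)"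
    proof (rule Lim_emeasure_decseq)
      show "range (\<lambda>N. ?U - ?D N) \<subseteq> sets M"
        using sets.Diff[OF op[OF U] cl[OF D]] by blast
      show "decseq (\<lambda>N. ?U - ?D N)"
        unfolding decseq_def by (intro allI impI Diff_mono UN_mono) auto
    qed simp
    moreover have "(\<Inter>N. ?U - ?D N) = ?U - (\<Union>n. C n)"
      by blast
    ultimately have "(\<lambda>N. emeasure M (?U - ?D N)) \<longlonglongrightarrow> emeasure M (?U - (\<Union>n. C n))"
      by metis
    then have "\<forall>\<^sub>F N in sequentially. emeasure M (?U - ?D N) < ennreal \<epsilon>"
      using less by (rule order_tendstoD)
    then obtain N where N: "emeasure M (?U - ?D N) < ennreal \<epsilon>"
      using eventually_happens trivial_limit_sequentially by blast
    have "?D N \<subseteq> (\<Union>n. A n)" "(\<Union>n. A n) \<subseteq> ?U"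
      using CU(3,4) by blast+
    then show ?case
      using N D U by (intro exI[of _ "?D N"] exI[of _ ?U]) simp
  qed
  show ?thesis
    unfolding radon_measure_def
  proof (intro conjI ballI allI impI M)
    fix A and \<epsilon> :: real assume A: "A \<in> borel_sets K" "0 < \<epsilon>"
    obtain C U where CU: "closedin K C" "openin K U" "C \<subseteq> A" "A \<subseteq> U" "emeasure M (U - C) < ennreal \<epsilon>"
      using approx[OF A[unfolded borel_sets_def]] by (elim exE conjE)
    have "A \<in> sets M" using A M by simp
    have "emeasure M (A - C) \<le> emeasure M (U - C)"
      by (intro emeasure_mono Diff_mono CU subset_refl sets.Diff op cl)
    then have "emeasure M (A - C) < ennreal \<epsilon>"
      using CU(5) by (rule le_less_trans)
    then show "\<exists>C. compactin K C \<and> C \<subseteq> A \<and> emeasure M (A - C) < ennreal \<epsilon>"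
      using CU(1,3) K closedin_compact_space by blast
  qed
qed

text \<open>A compact set filling the preimage of \<open>U\<close> has a compact image, and what
  this image misses in \<open>U\<close> pulls back into what the compact set misses. The measure
  \<open>to_measure L (\<lambda>_. 0)\<close> only carries the Borel sets of
  \<open>L\<close>.\<close>

lemma radon_measure_distr:
  assumes K: "compact_space K" "Hausdorff_space K" and L: "compact_space L" "Hausdorff_space L"
    and M: "radon_measure K M" and h: "continuous_map K L h"
  shows "radon_measure L (distr M (to_measure L (\<lambda>_. 0)) h)" (is "radon_measure L ?N")
proof (rule radon_measureI)
  note MD = radon_measureD[OF M]
  interpret finite_measure M by (rule MD)
  have hm: "h \<in> measurable M (to_measure L (\<lambda>_. 0))"
    by (rule measurable_continuous_map[OF MD(1) _ h]) simp
  show N: "sets ?N = borel_sets L"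
    by simp
  show "finite_measure ?N"
    by (rule finite_measure_distr[OF hm])
  fix U and \<epsilon> :: real assume U: "openin L U" and \<epsilon>: "0 < \<epsilon>"
  let ?V = "h -` U \<inter> space M"
  have "?V \<in> borel_sets K"
    using measurable_sets[OF hm, of U] openin_imp_borel_sets[OF U] by (simp add: MD)
  then obtain C where C: "compactin K C" "C \<subseteq> ?V" "emeasure M (?V - C) < ennreal \<epsilon>"
    by (rule radon_measureE[OF M _ \<epsilon>])
  have hC: "compactin L (h ` C)"
    by (rule image_compactin[OF C(1) h])
  have "U - h ` C \<in> borel_sets L"
    by (intro borel_sets_Diff openin_imp_borel_sets compactin_imp_borel_sets U L hC)
  then have "emeasure ?N (U - h ` C) = emeasure M (h -` (U - h ` C) \<inter> space M)"
    by (intro emeasure_distr[OF hm]) simp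
  also have "\<dots> \<le> emeasure M (?V - C)"
  proof (rule emeasure_mono)
    show "?V - C \<in> sets M"
      using \<open>?V \<in> borel_sets K\<close> compactin_imp_borel_sets[OF K(2) C(1)]
      unfolding MD(1) by (rule borel_sets_Diff)
  qed blast
  also note C(3)
  finally have "emeasure ?N (U - h ` C) < ennreal \<epsilon>" .
  moreover have "closedin L (h ` C)"
    using L(2) hC by (rule compactin_imp_closedin)
  moreover have "h ` C \<subseteq> U"
    using C(2) by blast
  ultimately show "\<exists>C. closedin L C \<and> C \<subseteq> U \<and> emeasure ?N (U - C) < ennreal \<epsilon>"
    by (intro exI[of _ "h ` C"] conjI)
qed (fact L)

section \<open>Compactifications\<close>

lemma embedding_mapD:
  assumes "embedding_map X Y f"
  shows "continuous_map X Y f" "inj_on f (topspace X)"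
    and "\<And>U. openin X U \<Longrightarrow> \<exists>V. openin Y V \<and> f ` U = V \<inter> f ` topspace X"
proof -
  have f: "homeomorphic_map X (subtopology Y (f ` topspace X)) f"
    using assms by (simp add: embedding_map_def)
  show "continuous_map X Y f"
    using homeomorphic_imp_continuous_map[OF f] continuous_map_into_fulltopology by blast
  show "inj_on f (topspace X)"
    by (rule homeomorphic_imp_injective_map[OF f])
  fix U assume "openin X U"
  then have "openin (subtopology Y (f ` topspace X)) (f ` U)"
    using homeomorphic_imp_open_map[OF f] unfolding open_map_def by blast
  then show "\<exists>V. openin Y V \<and> f ` U = V \<inter> f ` topspace X"
    unfolding openin_subtopology .
qed

text \<open>The extension \<open>h\<close> sends no further points into the copy of
  \<open>C\<close>. Otherwise separate \<open>p\<close> from \<open>C\<close> by disjoint open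
  \<open>U\<close> and \<open>V\<close>, and take \<open>V'\<close> open in \<open>K\<close> with
  the same trace on \<open>X\<close> as \<open>V\<close>. Then \<open>h p\<close> is in
  \<open>V'\<close>, so by density some point of \<open>X\<close> lies in \<open>U\<close> and is
  mapped into \<open>V'\<close>; it lies in \<open>V\<close> too, a contradiction.\<close>

lemma stone_cech_preimage_compactin:
  assumes K: "Hausdorff_space K" and e: "embedding_map X K e"
    and X: "tychonoff_space X"
    and h: "continuous_map (stone_cech X) K h"
    and he: "\<And>x. x \<in> topspace X \<Longrightarrow> h (stone_cech_embed X x) = e x"
    and C: "compactin X C" and p: "p \<in> topspace (stone_cech X)" "h p \<in> e ` C"
  shows "p \<in> stone_cech_embed X ` C"
proof (rule ccontr)
  let ?B = "stone_cech X" and ?i = "stone_cech_embed X"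
  assume np: "p \<notin> ?i ` C"
  have ci: "continuous_map X ?B ?i"
    by (rule embedding_mapD(1)[OF embedding_map_stone_cech[OF X]])
  have "compactin ?B (?i ` C)"
    by (rule image_compactin[OF C ci])
  then obtain U V where UV: "openin ?B U" "openin ?B V" "p \<in> U" "?i ` C \<subseteq> V" "U \<inter> V = {}"
    using Hausdorff_space_compact_separation[OF Hausdorff_space_stone_cech, of X "{p}" "?i ` C"] p(1) np
    by (auto simp: disjnt_def)
  let ?W = "{x \<in> topspace X. ?i x \<in> V}"
  have W: "openin X ?W"
    by (rule openin_continuous_map_preimage[OF ci UV(2)])
  obtain V' where V': "openin K V'" "e ` ?W = V' \<inter> e ` topspace X"
    using embedding_mapD(3)[OF e W] by blast
  have "C \<subseteq> ?W"
    using compactin_subset_topspace[OF C] UV(4) by blast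
  then have "h p \<in> V'"
    using p(2) V'(2) by blast
  let ?T = "U \<inter> {q \<in> topspace ?B. h q \<in> V'}"
  have "p \<in> ?T"
    using UV(3) p(1) \<open>h p \<in> V'\<close> by blast
  moreover have "openin ?B ?T"
    by (intro openin_Int UV openin_continuous_map_preimage[OF h V'(1)])
  moreover have "p \<in> ?B closure_of (?i ` topspace X)"
    unfolding dense_stone_cech by (rule p(1))
  then have "\<forall>T. p \<in> T \<and> openin ?B T \<longrightarrow> (\<exists>y. y \<in> ?i ` topspace X \<and> y \<in> T)"
    unfolding in_closure_of by (rule conjunct2)
  ultimately have "\<exists>y. y \<in> ?i ` topspace X \<and> y \<in> ?T"
    by (elim allE[of _ ?T] impE) (intro conjI)
  then obtain x where x: "x \<in> topspace X" "?i x \<in> U" "h (?i x) \<in> V'"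
    by blast
  have "e x \<in> V'"
    using x(3) he[OF x(1)] by simp
  then have "e x \<in> e ` ?W"
    unfolding V'(2) using x(1) by blast
  then obtain y where "y \<in> topspace X" "?i y \<in> V" "e x = e y"
    by blast
  moreover have "inj_on e (topspace X)"
    by (rule embedding_mapD(2)[OF e])
  ultimately have "?i x \<in> V"
    using x(1) by (metis inj_onD)
  then show False
    using x(2) UV(5) by blast
qed

text \<open>Two compact spaces containing \<open>X\<close> induce the same Borel sets on \<open>X\<close>. Hence the
  trace on \<open>X\<close> of the outer measure of a Radon measure on one of them can be pushed forward to
  the other one. Regularity holds since, for an open set \<open>U\<close>, the open sets with closure inside
  \<open>U\<close> have the same trace as open sets covering the trace of \<open>U\<close>, to which inner regularity of
  \<open>M\<close> applies.\<close>

lemma radon_measure_transfer: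
  fixes X :: "'x topology" and B :: "'a topology" and K :: "'b topology"
  assumes B: "compact_space B" "Hausdorff_space B" and i: "embedding_map X B i"
    and K: "compact_space K" "Hausdorff_space K" and e: "embedding_map X K e"
    and M: "radon_measure K M"
  shows "\<exists>L. radon_measure B L \<and>
    (\<forall>A\<in>borel_sets B. emeasure L A = outer_measure_of M (e ` {x \<in> topspace X. i x \<in> A}))"
proof -
  note MD = radon_measureD[OF M]
  interpret finite_measure M by (rule MD)
  let ?X = "e ` topspace X"
  \<comment> \<open>The copy in \<open>K\<close> of the part of \<open>X\<close> inside
    \<open>A\<close>. It need not be \<open>M\<close>-measurable, hence the outer measure in
    \<open>l\<close>.\<close>
  define tr where "tr A = e ` {x \<in> topspace X. i x \<in> A}" for A
  define l where "l A = outer_measure_of M (tr A)" for A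
  have inj: "inj_on e (topspace X)"
    by (rule embedding_mapD(2)[OF e])
  have tr_Diff: "tr (A - A') = tr A - tr A'" for A A'
    using inj unfolding tr_def by (subst inj_on_image_set_diff[OF inj, symmetric]) auto
  have tr_UN: "tr (\<Union>n. F n) = (\<Union>n. tr (F n))" for F :: "nat \<Rightarrow> 'a set"
    unfolding tr_def by blast
  have tr_mono: "tr A \<subseteq> tr A'" if "A \<subseteq> A'" for A A'
    using that unfolding tr_def by blast
  have ix: "i x \<in> topspace B" if "x \<in> topspace X" for x
    using continuous_map_image_subset_topspace[OF embedding_mapD(1)[OF i]] that by blast
  have XK: "?X \<subseteq> topspace K"
    by (rule continuous_map_image_subset_topspace[OF embedding_mapD(1)[OF e]])
  have tr_open: "\<exists>V. openin K V \<and> tr U = V \<inter> ?X" if "openin B U" for U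
    unfolding tr_def
    by (intro embedding_mapD(3)[OF e] openin_continuous_map_preimage[OF embedding_mapD(1)[OF i] that])
  have tr_borel: "\<exists>A'. A' \<in> sets M \<and> tr A = A' \<inter> ?X" if "A \<in> sigma_sets (topspace B) {U. openin B U}" for A
    using that
  proof induction
    case (Basic U)
    then have "openin B U"
      by simp
    from tr_open[OF this] show ?case
      unfolding MD(1) using openin_imp_borel_sets by metis
  next
    case Empty
    show ?case
      by (intro exI[of _ "{}"]) (simp add: tr_def)
  next
    case (Compl A)
    then obtain A' where A': "A' \<in> sets M" "tr A = A' \<inter> ?X"
      by (elim exE conjE)
    have "tr (topspace B) = ?X"
      unfolding tr_def using ix by blast
    then have "tr (topspace B - A) = (space M - A') \<inter> ?X"
      unfolding tr_Diff A' MD(2) using XK by blast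
    then show ?case
      using sets.compl_sets[OF A'(1)] by (intro exI[of _ "space M - A'"] conjI)
  next
    case (Union A)
    then obtain A' where A': "\<And>n::nat. A' n \<in> sets M" "\<And>n. tr (A n) = A' n \<inter> ?X"
      by metis
    have "tr (\<Union>n. A n) = (\<Union>n. A' n) \<inter> ?X"
      unfolding tr_UN A' by blast
    moreover have "(\<Union>n. A' n) \<in> sets M"
      by (intro sets.countable_nat_UN image_subsetI A')
    ultimately show ?case
      by (intro exI[of _ "\<Union>n. A' n"] conjI)
  qed
  \<comment> \<open>The envelope \<open>G\<close> replaces the outer measure of a trace
    \<open>A' \<inter> ?X\<close> by the measure of \<open>A' \<inter> G\<close>, so additivity of
    \<open>l\<close> is inherited from \<open>M\<close>.\<close>
  obtain G where G: "measurable_envelope M ?X G"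
  proof -
    obtain E where E: "E \<in> sets M" "?X \<subseteq> E" "outer_measure_of M ?X = emeasure M E"
      using outer_measure_of_attain[of ?X M] XK unfolding MD(2) by blast
    then have "measurable_envelope M ?X E"
      by (subst measurable_envelope_eq2) (simp_all add: less_top[symmetric])
    then show thesis
      by (rule that)
  qed
  note GD = measurable_envelopeD[OF G]
  have l_eq: "l A = emeasure M (A' \<inter> G)" if "A' \<in> sets M" "tr A = A' \<inter> ?X" for A A'
    unfolding l_def that(2) by (rule GD(3)[OF that(1), symmetric])
  have l_add: "countably_additive (borel_sets B) l"
  proof (rule countably_additiveI)
    fix F :: "nat \<Rightarrow> 'a set"
    assume F: "range F \<subseteq> borel_sets B" "disjoint_family F" "(\<Union>n. F n) \<in> borel_sets B"
    have "\<exists>A'. A' \<in> sets M \<and> tr (F n) = A' \<inter> ?X" for n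
      using subsetD[OF F(1) rangeI] unfolding borel_sets_def by (rule tr_borel)
    then obtain A where A: "\<And>n. A n \<in> sets M" "\<And>n. tr (F n) = A n \<inter> ?X"
      by metis
    \<comment> \<open>The traces are disjoint, but the sets \<open>A n\<close> may overlap off
      \<open>X\<close>. Passing to \<open>disjointed A\<close> removes the overlap and preserves the
      traces.\<close>
    have D: "disjointed A n \<in> sets M" for n
      using sets.range_disjointed_sets[of A] A(1) by blast
    have tr_disj: "tr (F m) \<inter> tr (F n) = {}" if "m \<noteq> n" for m n
    proof -
      have "F m - F n = F m"
        using disjoint_family_onD[OF F(2) _ _ that] by auto
      then have "tr (F m) - tr (F n) = tr (F m)"
        using tr_Diff[of "F m" "F n"] by simp
      then show ?thesis
        by blast
    qed
    have trD: "tr (F n) = disjointed A n \<inter> ?X" for n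
    proof -
      have "disjointed A n \<inter> ?X = tr (F n) - (\<Union>m\<in>{0..<n}. tr (F m))"
        unfolding disjointed_def A(2) by blast
      also have "\<dots> = tr (F n)"
      proof -
        have "tr (F m) \<inter> tr (F n) = {}" if "m \<in> {0..<n}" for m
          using that by (intro tr_disj) simp
        then show ?thesis
          by blast
      qed
      finally show ?thesis
        by simp
    qed
    have DG: "range (\<lambda>n. disjointed A n \<inter> G) \<subseteq> sets M"
      by (intro image_subsetI sets.Int D GD)
    have "disjoint_family (\<lambda>n. disjointed A n \<inter> G)"
      using disjoint_family_disjointed[of A] by (simp add: disjoint_family_on_def) blast
    with DG have "(\<Sum>n. emeasure M (disjointed A n \<inter> G)) = emeasure M (\<Union>n. disjointed A n \<inter> G)"
      by (rule suminf_emeasure)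
    also have "(\<Union>n. disjointed A n \<inter> G) = (\<Union>n. disjointed A n) \<inter> G"
      by blast
    also have "emeasure M \<dots> = l (\<Union>n. F n)"
    proof (rule l_eq[symmetric])
      show "(\<Union>n. disjointed A n) \<in> sets M"
        by (intro sets.countable_nat_UN image_subsetI D)
      show "tr (\<Union>n. F n) = (\<Union>n. disjointed A n) \<inter> ?X"
        unfolding tr_UN trD by blast
    qed
    also have "(\<Sum>n. emeasure M (disjointed A n \<inter> G)) = (\<Sum>n. l (F n))"
      by (intro suminf_cong l_eq[symmetric] D trD)
    finally show "(\<Sum>n. l (F n)) = l (\<Union>n. F n)" .
  qed
  define L where "L = measure_of (topspace B) (borel_sets B) l"
  have L: "sets L = borel_sets B"
    unfolding L_def by (rule sigma_algebra.sets_measure_of_eq[OF sigma_algebra_borel_sets])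
  have emL: "emeasure L A = l A" if "A \<in> borel_sets B" for A
    unfolding L_def
  proof (rule emeasure_measure_of_sigma[OF sigma_algebra_borel_sets _ l_add that])
    have "l {} = 0"
      unfolding l_def tr_def by simp
    then show "positive (borel_sets B) l"
      by (simp add: positive_def)
  qed
  have "radon_measure B L"
  proof (rule radon_measureI[OF B(1) L])
    have "l (topspace B) \<le> outer_measure_of M (space M)"
      unfolding l_def MD(2) by (rule outer_measure_of_mono) (use XK in \<open>auto simp: tr_def\<close>)
    also have "\<dots> < \<infinity>"
      by (simp add: less_top[symmetric])
    finally show "finite_measure L"
      using emL[OF openin_imp_borel_sets[OF openin_topspace]] space_eq_topspace[OF L]
      by (intro finite_measureI) simp
  next
    fix U and \<epsilon> :: real assume U: "openin B U" and \<epsilon>: "0 < \<epsilon>"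
    \<comment> \<open>By regularity of \<open>B\<close> the members of \<open>\<W>\<close> cover the
      trace of \<open>U\<close>. A compact set covered by \<open>\<W>\<close> needs finitely many of
      them, and the union of the corresponding sets \<open>D\<close> is then closed and inside
      \<open>U\<close>.\<close>
    define \<W> where "\<W> = {W. openin K W \<and>
      (\<exists>Q D. openin B Q \<and> closedin B D \<and> Q \<subseteq> D \<and> D \<subseteq> U \<and> tr Q = W \<inter> ?X)}"
    have opW: "openin K (\<Union>\<W>)"
      by (intro openin_Union) (simp add: \<W>_def)
    have trU: "tr U \<subseteq> \<Union>\<W>"
    proof
      fix y assume "y \<in> tr U"
      then obtain x where x: "x \<in> topspace X" "i x \<in> U" "y = e x"
        unfolding tr_def by blast
      have "neighbourhood_base_of (closedin B) B"
        unfolding neighbourhood_base_of_closedin by (rule compact_Hausdorff_imp_regular_space[OF B])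
      then obtain Q D where QD: "openin B Q" "closedin B D" "i x \<in> Q" "Q \<subseteq> D" "D \<subseteq> U"
        using U x(2) unfolding neighbourhood_base_of by meson
      obtain W where W: "openin K W" "tr Q = W \<inter> ?X"
        using tr_open[OF QD(1)] by (elim exE conjE)
      have "W \<in> \<W>"
        unfolding \<W>_def mem_Collect_eq by (intro conjI exI[of _ Q] exI[of _ D] W QD)
      moreover have "y \<in> tr Q"
        unfolding tr_def using x QD(3) by blast
      ultimately show "y \<in> \<Union>\<W>"
        unfolding W(2) by blast
    qed
    obtain V where V: "openin K V" "tr U = V \<inter> ?X"
      using tr_open[OF U] by (elim exE conjE)
    let ?V = "V \<inter> \<Union>\<W>"
    have Vb: "?V \<in> borel_sets K"
      by (intro openin_imp_borel_sets openin_Int V opW)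
    obtain C where C: "compactin K C" "C \<subseteq> ?V" "emeasure M (?V - C) < ennreal \<epsilon>"
      by (rule radon_measureE[OF M Vb \<epsilon>])
    have "\<exists>\<F>. finite \<F> \<and> \<F> \<subseteq> \<W> \<and> C \<subseteq> \<Union>\<F>"
    proof -
      have "\<forall>W\<in>\<W>. openin K W" "C \<subseteq> \<Union>\<W>"
        using C(2) by (auto simp: \<W>_def)
      then show ?thesis
        using C(1) unfolding compactin_def by meson
    qed
    then obtain \<F> where \<F>: "finite \<F>" "\<F> \<subseteq> \<W>" "C \<subseteq> \<Union>\<F>"
      by (elim exE conjE)
    have "\<forall>W\<in>\<F>. \<exists>Q D. openin B Q \<and> closedin B D \<and> Q \<subseteq> D \<and> D \<subseteq> U \<and> tr Q = W \<inter> ?X"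
      using \<F>(2) unfolding \<W>_def by blast
    then obtain Q D where QD: "\<And>W. W \<in> \<F> \<Longrightarrow> closedin B (D W)" "\<And>W. W \<in> \<F> \<Longrightarrow> Q W \<subseteq> D W"
        "\<And>W. W \<in> \<F> \<Longrightarrow> D W \<subseteq> U" "\<And>W. W \<in> \<F> \<Longrightarrow> tr (Q W) = W \<inter> ?X"
      by metis
    let ?D = "\<Union>W\<in>\<F>. D W"
    have D: "closedin B ?D"
      using \<F>(1) QD(1) by (intro closedin_Union) auto
    have DU: "?D \<subseteq> U"
      using QD(3) by blast
    have "C \<inter> ?X \<subseteq> tr ?D"
    proof
      fix y assume "y \<in> C \<inter> ?X"
      then obtain W where W: "W \<in> \<F>" "y \<in> W \<inter> ?X"
        using \<F>(3) by blast
      then have "y \<in> tr (Q W)"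
        using QD(4) by blast
      moreover have "tr (Q W) \<subseteq> tr ?D"
        using W(1) QD(2) by (intro tr_mono) blast
      ultimately show "y \<in> tr ?D"
        by blast
    qed
    \<comment> \<open>The trace of \<open>U\<close> lies in \<open>?V\<close>, and its points in
      \<open>C\<close> are caught by \<open>?D\<close>; the rest falls into the small set
      \<open>?V - C\<close>.\<close>
    then have "tr (U - ?D) \<subseteq> ?V - C"
      unfolding tr_Diff using trU V(2) by blast
    then have "l (U - ?D) \<le> outer_measure_of M (?V - C)"
      unfolding l_def by (rule outer_measure_of_mono)
    also have "\<dots> = emeasure M (?V - C)"
    proof (rule outer_measure_of_eq)
      show "?V - C \<in> sets M"
        unfolding MD(1) by (intro borel_sets_Diff Vb compactin_imp_borel_sets[OF K(2) C(1)])
    qed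
    also note C(3)
    finally have "l (U - ?D) < ennreal \<epsilon>" .
    moreover have "U - ?D \<in> borel_sets B"
      by (intro borel_sets_Diff openin_imp_borel_sets[OF U] closedin_imp_borel_sets[OF D])
    ultimately have "emeasure L (U - ?D) < ennreal \<epsilon>"
      using emL by simp
    then show "\<exists>C. closedin B C \<and> C \<subseteq> U \<and> emeasure L (U - C) < ennreal \<epsilon>"
      by (intro exI[of _ ?D] conjI D DU)
  qed
  then show ?thesis
    using emL unfolding l_def tr_def by (intro exI[of _ L] conjI) simp_all
qed

section \<open>Universal measurability\<close>

lemma sigma_compactin_image_borel:
  assumes "continuous_map X K f" "Hausdorff_space K" "sigma_compactin X S"
  shows "f ` S \<in> borel_sets K" "S \<subseteq> topspace X"
proof -
  obtain C where C: "\<And>n::nat. compactin X (C n)" "S = (\<Union>n. C n)"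
    using assms(3) unfolding sigma_compactin_def by blast
  have "(\<Union>n. f ` C n) \<in> borel_sets K"
    by (intro borel_sets_UN compactin_imp_borel_sets assms(2) image_compactin[OF C(1) assms(1)])
  then show "f ` S \<in> borel_sets K"
    unfolding C(2) image_UN .
  show "S \<subseteq> topspace X"
    unfolding C(2) using compactin_subset_topspace[OF C(1)] by blast
qed

lemma stone_cech_embed_continuous_map:
  "tychonoff_space X \<Longrightarrow> continuous_map X (stone_cech X) (stone_cech_embed X)"
  by (rule embedding_mapD(1)[OF embedding_map_stone_cech])

lemma universally_tau_measurable_imp_measurable_wrt:
  assumes X: "tychonoff_space X" "universally_tau_measurable X"
    and K: "compact_space K" "Hausdorff_space K" and e: "embedding_map X K e"
    and \<mu>: "\<mu> \<in> prob_measures K"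
  shows "measurable_wrt K \<mu> (e ` topspace X)"
proof -
  let ?B = "stone_cech X" and ?i = "stone_cech_embed X"
  let ?M = "to_measure K \<mu>"
  note B = compact_space_stone_cech[of X] Hausdorff_space_stone_cech[of X]
  note i = embedding_map_stone_cech[OF X(1)]
  obtain L where L: "radon_measure ?B L"
    "\<And>A. A \<in> borel_sets ?B \<Longrightarrow> emeasure L A = outer_measure_of ?M (e ` {x \<in> topspace X. ?i x \<in> A})"
    using radon_measure_transfer[OF B i K e radon_to_measure[OF K \<mu>]] by blast
  note LD = radon_measureD[OF L(1)]
  have "measure L \<in> M_tau X"
    unfolding M_tau_def
  proof (intro CollectI conjI allI impI)
    show "measure L \<in> signed_measures ?B"
      by (rule measure_in_signed_measures[OF B L(1)])
    fix C assume "compactin ?B C \<and> C \<subseteq> topspace ?B - ?i ` topspace X"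
    then have C: "compactin ?B C" "C \<subseteq> topspace ?B - ?i ` topspace X"
      by blast+
    then have empty: "{x \<in> topspace X. ?i x \<in> C} = {}"
      by blast
    have Cb: "C \<in> borel_sets ?B"
      by (rule compactin_imp_borel_sets[OF B(2) C(1)])
    show "total_variation ?B (measure L) C = 0"
      unfolding total_variation_measure[OF LD(1,3) Cb] L(2)[OF Cb] empty image_empty
      by (simp add: outer_measure_of_eq[OF sets.empty_sets])
  qed
  then have "measure L \<in> M_R X"
    using X(2) by (simp add: universally_tau_measurable_def)
  then obtain S where S: "sigma_compactin X S" "total_variation ?B (measure L) (topspace ?B - ?i ` S) = 0"
    unfolding M_R_def by blast
  note SX = sigma_compactin_image_borel(2)[OF stone_cech_embed_continuous_map[OF X(1)] B(2) S(1)]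
  have b: "topspace ?B - ?i ` S \<in> borel_sets ?B"
    by (intro borel_sets_Diff openin_imp_borel_sets openin_topspace
        sigma_compactin_image_borel(1)[OF stone_cech_embed_continuous_map[OF X(1)] B(2) S(1)])
  let ?T = "{x \<in> topspace X. ?i x \<in> topspace ?B - ?i ` S}"
  \<comment> \<open>By the choice of \<open>L\<close>, that the complement of \<open>S\<close> is
    null for \<open>L\<close> means that the copy of \<open>X - S\<close> in \<open>K\<close> has
    outer measure 0.\<close>
  have zero: "outer_measure_of ?M (e ` ?T) = 0"
    using S(2) b by (simp add: total_variation_measure LD L(2))
  have "e ` ?T \<subseteq> space ?M"
    using continuous_map_image_subset_topspace[OF embedding_mapD(1)[OF e]] unfolding space_to_measure
    by blast
  \<comment> \<open>The outer measure is attained by a measurable cover, here a null set; in this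
    form the completion admits the remainder of \<open>X\<close>.\<close>
  then obtain N where "N \<in> sets ?M" "e ` ?T \<subseteq> N" "outer_measure_of ?M (e ` ?T) = emeasure ?M N"
    using outer_measure_of_attain[of "e ` ?T" ?M] by (elim meta_impE bexE conjE)
  then have N: "N \<in> null_sets ?M" "e ` ?T \<subseteq> N"
    using zero by (auto intro: null_setsI)
  have T: "?T = topspace X - S"
  proof -
    have "?i x \<in> ?i ` S \<longleftrightarrow> x \<in> S" if "x \<in> topspace X" for x
      by (rule inj_on_image_mem_iff[OF embedding_mapD(2)[OF i] that SX])
    moreover have "?i x \<in> topspace ?B" if "x \<in> topspace X" for x
      using subsetD[OF stone_cech_embed_image imageI[OF that]] .
    ultimately show ?thesis
      by auto
  qed
  have "e ` topspace X = e ` S \<union> e ` ?T"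
    unfolding T using SX by blast
  moreover have "e ` S \<in> sets ?M"
    unfolding sets_to_measure by (rule sigma_compactin_image_borel(1)[OF embedding_mapD(1)[OF e] K(2) S(1)])
  ultimately show ?thesis
    unfolding measurable_wrt_def using N by (intro sets_completionI)
qed

section \<open>From measurability in a compact space to universal \<tau>-measurability\<close>

lemma compactin_embedding_preimage:
  assumes e: "embedding_map X K e" and D: "compactin K D" "D \<subseteq> e ` topspace X"
  shows "compactin X {x \<in> topspace X. e x \<in> D}" (is "compactin X ?C")
proof -
  have eC: "e ` ?C = D"
    using D(2) by blast
  have "homeomorphic_map X (subtopology K (e ` topspace X)) e"
    using e by (simp add: embedding_map_def)
  moreover have "compactin (subtopology K (e ` topspace X)) (e ` ?C)"
    unfolding eC compactin_subtopology using D by (rule conjI)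
  ultimately show ?thesis
    by (subst (asm) homeomorphic_map_compactness) auto
qed

text \<open>A compact set that misses \<open>X\<close> also misses the \<sigma>-compact set carrying
  the measure, so monotonicity of the total variation applies.\<close>

lemma M_R_subset_M_tau:
  assumes X: "tychonoff_space X"
  shows "M_R X \<subseteq> M_tau X"
proof
  let ?B = "stone_cech X" and ?i = "stone_cech_embed X"
  fix \<mu> assume "\<mu> \<in> M_R X"
  then obtain S where \<mu>: "\<mu> \<in> signed_measures ?B" and S: "sigma_compactin X S"
      "total_variation ?B \<mu> (topspace ?B - ?i ` S) = 0"
    unfolding M_R_def by blast
  note Sb = sigma_compactin_image_borel[OF stone_cech_embed_continuous_map[OF X] Hausdorff_space_stone_cech S(1)]
  have "total_variation ?B \<mu> C = 0" if C: "compactin ?B C" "C \<subseteq> topspace ?B - ?i ` topspace X" for C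
  proof -
    have "total_variation ?B \<mu> C \<le> total_variation ?B \<mu> (topspace ?B - ?i ` S)"
    proof (rule total_variation_mono)
      show "signed_borel_measure ?B \<mu>"
        using \<mu> by (simp add: signed_measures_def)
      show "C \<subseteq> topspace ?B - ?i ` S"
        using C(2) Sb(2) by blast
    qed (intro borel_sets_Diff openin_imp_borel_sets openin_topspace Sb
        compactin_imp_borel_sets[OF Hausdorff_space_stone_cech C(1)])+
    then show ?thesis
      using S(2) by simp
  qed
  then show "\<mu> \<in> M_tau X"
    unfolding M_tau_def using \<mu> by blast
qed

text \<open>The set consists of a Borel set and part of a null set. Compact sets exhaust the Borel
  set up to another null set, and \<open>Z\<close> collects both errors.\<close>

lemma completion_sigma_compact:
  assumes K: "Hausdorff_space K" and M: "radon_measure K M" and A: "A \<in> sets (completion M)"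
  shows "\<exists>(C :: nat \<Rightarrow> 'a set) Z. (\<forall>n. compactin K (C n) \<and> C n \<subseteq> A) \<and>
    Z \<in> null_sets M \<and> A - (\<Union>n. C n) \<subseteq> Z"
proof -
  obtain S N N' where S: "A = S \<union> N" "N \<subseteq> N'" "N' \<in> null_sets M" "S \<in> sets M"
    using A by (rule sets_completionE)
  have Sb: "S \<in> borel_sets K"
    using S(4) unfolding radon_measureD[OF M] .
  obtain C :: "nat \<Rightarrow> 'a set" where C: "\<And>n. compactin K (C n)" "\<And>n. C n \<subseteq> S"
      "emeasure M (S - (\<Union>n. C n)) = 0"
    using radon_measure_sigma_compact[OF K M Sb] by blast
  have "S - (\<Union>n. C n) \<in> sets M"
    unfolding radon_measureD[OF M]
    by (intro borel_sets_Diff Sb borel_sets_UN compactin_imp_borel_sets K C)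
  then have "(S - (\<Union>n. C n)) \<union> N' \<in> null_sets M"
    by (intro null_sets.Un null_setsI C(3) S(3))
  moreover have "A - (\<Union>n. C n) \<subseteq> (S - (\<Union>n. C n)) \<union> N'"
    using S(1,2) by blast
  moreover have "C n \<subseteq> A" for n
    using C(2) S(1) by blast
  ultimately show ?thesis
    using C(1) by blast
qed

lemma measurable_wrt_imp_universally_tau_measurable:
  assumes X: "tychonoff_space X"
    and K: "compact_space K" "Hausdorff_space K" and e: "embedding_map X K e"
    and meas: "\<And>\<mu>. \<mu> \<in> prob_measures K \<Longrightarrow> measurable_wrt K \<mu> (e ` topspace X)"
  shows "universally_tau_measurable X"
proof -
  let ?B = "stone_cech X" and ?i = "stone_cech_embed X"
  let ?X = "e ` topspace X"
  note B = compact_space_stone_cech[of X] Hausdorff_space_stone_cech[of X]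
  obtain h where h: "continuous_map ?B K h" "\<And>x. x \<in> topspace X \<Longrightarrow> h (?i x) = e x"
    using stone_cech_extension[OF K embedding_mapD(1)[OF e]] by blast
  have XK: "?X \<subseteq> topspace K"
    by (rule continuous_map_image_subset_topspace[OF embedding_mapD(1)[OF e]])
  have "M_tau X \<subseteq> M_R X"
  proof
    fix \<mu> assume "\<mu> \<in> M_tau X"
    then have \<mu>: "\<mu> \<in> signed_measures ?B"
        and tau: "\<And>C. compactin ?B C \<Longrightarrow> C \<subseteq> topspace ?B - ?i ` topspace X \<Longrightarrow> total_variation ?B \<mu> C = 0"
      unfolding M_tau_def by blast+
    have s: "signed_borel_measure ?B \<mu>"
      using \<mu> by (simp add: signed_measures_def)
    let ?V = "variation_measure ?B \<mu>"
    let ?N = "distr ?V (to_measure K (\<lambda>_. 0)) h"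
    have V: "radon_measure ?B ?V"
      by (rule radon_variation_measure[OF B \<mu>])
    note VD = radon_measureD[OF V]
    have N: "radon_measure K ?N"
      by (rule radon_measure_distr[OF B K V h(1)])
    have hm: "h \<in> measurable ?V (to_measure K (\<lambda>_. 0))"
      by (rule measurable_continuous_map[OF VD(1) sets_to_measure h(1)])
    have emN: "emeasure ?N A = total_variation ?B \<mu> (h -` A \<inter> topspace ?B)"
      and preb: "h -` A \<inter> topspace ?B \<in> borel_sets ?B" if "A \<in> borel_sets K" for A
    proof -
      show "h -` A \<inter> topspace ?B \<in> borel_sets ?B"
        using measurable_sets[OF hm, of A] that unfolding VD sets_to_measure by blast
      then show "emeasure ?N A = total_variation ?B \<mu> (h -` A \<inter> topspace ?B)"
        using emeasure_distr[OF hm, of A] that emeasure_variation_measure[OF s] unfolding VD sets_to_measure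
        by metis
    qed
    \<comment> \<open>The image \<open>?N\<close> of the variation need not have mass 1, so
      measurability is taken from \<open>completion_if_measurable_wrt\<close>.\<close>
    have Xc: "?X \<in> sets (completion ?N)"
      by (rule completion_if_measurable_wrt[OF K N XK meas])
    then have "space (completion ?N) - ?X \<in> sets (completion ?N)"
      by (rule sets.compl_sets)
    then have Xc': "topspace K - ?X \<in> sets (completion ?N)"
      by simp
    obtain C Z where CZ: "\<forall>n. compactin K (C n) \<and> C n \<subseteq> ?X"
        and Z: "Z \<in> null_sets ?N" "?X - (\<Union>n::nat. C n) \<subseteq> Z"
      using completion_sigma_compact[OF K(2) N Xc] by (elim exE conjE)
    have C: "compactin K (C n)" "C n \<subseteq> ?X" for n
      using CZ[rule_format, of n] by (rule conjunct1, rule conjunct2)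
    obtain D Z' where DZ: "\<forall>n. compactin K (D n) \<and> D n \<subseteq> topspace K - ?X"
        and Z': "Z' \<in> null_sets ?N" "(topspace K - ?X) - (\<Union>n::nat. D n) \<subseteq> Z'"
      using completion_sigma_compact[OF K(2) N Xc'] by (elim exE conjE)
    have D: "compactin K (D n)" "D n \<subseteq> topspace K - ?X" for n
      using DZ[rule_format, of n] by (rule conjunct1, rule conjunct2)
    \<comment> \<open>Here \<tau>-additivity enters: the preimage of \<open>D n\<close> in \<beta>X
      is compact, and it misses \<open>X\<close> because \<open>h\<close> extends
      \<open>e\<close>.\<close>
    have Dnull: "D n \<in> null_sets ?N" for n
    proof -
      have Db: "D n \<in> borel_sets K"
        by (rule compactin_imp_borel_sets[OF K(2) D(1)])
      have "closedin ?B {p \<in> topspace ?B. h p \<in> D n}"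
        by (rule closedin_continuous_map_preimage[OF h(1) compactin_imp_closedin[OF K(2) D(1)]])
      moreover have "{p \<in> topspace ?B. h p \<in> D n} = h -` D n \<inter> topspace ?B"
        by blast
      ultimately have "compactin ?B (h -` D n \<inter> topspace ?B)"
        using closedin_compact_space[OF B(1)] by metis
      moreover have "h -` D n \<inter> topspace ?B \<subseteq> topspace ?B - ?i ` topspace X"
        using D(2)[of n] h(2) by fastforce
      ultimately have "emeasure ?N (D n) = 0"
        unfolding emN[OF Db] by (rule tau)
      then show ?thesis
        using Db by (intro null_setsI) simp_all
    qed
    \<comment> \<open>This null set contains every point of \<open>K\<close> outside the sets
      \<open>C n\<close>.\<close>
    let ?Z = "Z \<union> Z' \<union> (\<Union>n. D n)"
    have Znull: "?Z \<in> null_sets ?N"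
      by (intro null_sets.Un Z(1) Z'(1) null_sets_UN' Dnull) simp
    have Zb: "?Z \<in> borel_sets K"
      using null_setsD2[OF Znull] unfolding sets_distr sets_to_measure .
    let ?S = "\<Union>n. {x \<in> topspace X. e x \<in> C n}"
    have Cc: "compactin X {x \<in> topspace X. e x \<in> C n}" for n
      by (rule compactin_embedding_preimage[OF e C])
    then have S: "sigma_compactin X ?S"
      unfolding sigma_compactin_def by (intro exI[of _ "\<lambda>n. {x \<in> topspace X. e x \<in> C n}"]) simp
    \<comment> \<open>A point of \<beta>X with image in some \<open>C n\<close> belongs to the copy
      of \<open>?S\<close>, by \<open>stone_cech_preimage_compactin\<close>; all others are sent
      into \<open>?Z\<close>.\<close>
    have sub: "topspace ?B - ?i ` ?S \<subseteq> h -` ?Z \<inter> topspace ?B"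
    proof
      fix p assume p: "p \<in> topspace ?B - ?i ` ?S"
      have "h p \<notin> C n" for n
      proof
        assume hp: "h p \<in> C n"
        then obtain x where x: "x \<in> topspace X" "h p = e x"
          using subsetD[OF C(2)] by blast
        with hp have "h p \<in> e ` {x \<in> topspace X. e x \<in> C n}"
          by simp
        then have "p \<in> ?i ` {x \<in> topspace X. e x \<in> C n}"
          using DiffD1[OF p] by (intro stone_cech_preimage_compactin[OF K(2) e X h(1) h(2) Cc]) simp_all
        then show False
          using p by blast
      qed
      moreover have "h p \<in> topspace K"
        using continuous_map_image_subset_topspace[OF h(1)] p by blast
      ultimately consider "h p \<in> ?X - (\<Union>n. C n)" | "h p \<in> (\<Union>n. D n)"
        | "h p \<in> (topspace K - ?X) - (\<Union>n. D n)"
        by blast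
      then have "h p \<in> ?Z"
        by cases (use Z(2) Z'(2) in blast)+
      then show "p \<in> h -` ?Z \<inter> topspace ?B"
        by (intro IntI vimageI2 DiffD1[OF p])
    qed
    have "total_variation ?B \<mu> (topspace ?B - ?i ` ?S) \<le> total_variation ?B \<mu> (h -` ?Z \<inter> topspace ?B)"
    proof (rule total_variation_mono[OF s _ preb[OF Zb] sub])
      show "topspace ?B - ?i ` ?S \<in> borel_sets ?B"
        by (rule borel_sets_Diff[OF openin_imp_borel_sets[OF openin_topspace]
              sigma_compactin_image_borel(1)[OF stone_cech_embed_continuous_map[OF X] B(2) S]])
    qed
    also have "\<dots> = 0"
      using null_setsD1[OF Znull] unfolding emN[OF Zb] .
    finally have "total_variation ?B \<mu> (topspace ?B - ?i ` ?S) = 0"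
      by simp
    then show "\<mu> \<in> M_R X"
      unfolding M_R_def by (intro CollectI conjI exI[of _ ?S] \<mu> S)
  qed
  then show ?thesis
    unfolding universally_tau_measurable_def using M_R_subset_M_tau[OF X] by (rule subset_antisym)
qed

text \<open>An injection carries the topology of \<open>X\<close> over to its image in the type
  \<open>'b\<close>. This copy is the witness in (iii), and it keeps (iv) from being
  vacuous.\<close>

lemma embedding_into_type:
  assumes X: "tychonoff_space X" and card: "topspace X \<lesssim> (UNIV :: 'b set)"
  shows "\<exists>(Y :: 'b topology) f. tychonoff_space Y \<and> embedding_map X Y f"
proof -
  obtain g :: "'a \<Rightarrow> 'b" where g: "inj_on g (topspace X)"
    using card unfolding lepoll_def by blast
  let ?k = "inv_into (topspace X) g"
  let ?Y = "pullback_topology (g ` topspace X) ?k X"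
  have kg: "?k (g x) = x" if "x \<in> topspace X" for x
    by (rule inv_into_f_f[OF g that])
  have top: "topspace ?Y = g ` topspace X"
    unfolding topspace_pullback_topology using kg by auto
  have "continuous_map X X (?k \<circ> g)"
    by (rule continuous_map_eq[OF continuous_map_id]) (simp add: kg)
  then have "continuous_map X ?Y g"
    by (rule continuous_map_pullback') blast
  moreover have "continuous_map ?Y X ?k"
    using continuous_map_pullback[OF continuous_map_id, of _ ?k X] by simp
  ultimately have hom: "homeomorphic_maps X ?Y g ?k"
    unfolding homeomorphic_maps_def top using kg by auto
  then have "X homeomorphic_space ?Y"
    by (rule homeomorphic_maps_imp_homeomorphic_space)
  then have "tychonoff_space ?Y"
    using X homeomorphic_completely_regular_space homeomorphic_Hausdorff_space
    unfolding tychonoff_space_def by blast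
  moreover have "embedding_map X ?Y g"
  proof -
    have "homeomorphic_map X ?Y g"
      using hom homeomorphic_maps_map by blast
    then show ?thesis
      unfolding embedding_map_def using subtopology_topspace[of ?Y] unfolding top by simp
  qed
  ultimately show ?thesis
    by blast
qed

(* The type 'b is the universe in which the spaces Y live; it has to be large enough to contain
   a copy of X. Every space Y over any type into which X embeds is covered by a choice of 'b. *)
theorem theorem1:
  fixes X :: "'a topology"
  assumes "tychonoff_space X"
    and "topspace X \<lesssim> (UNIV :: 'b set)"
  shows "(universally_tau_measurable X
      \<longleftrightarrow> (\<forall>\<mu> \<in> prob_measures (stone_cech X).
             measurable_wrt (stone_cech X) \<mu> (stone_cech_embed X ` topspace X)))
    \<and> (universally_tau_measurable X
      \<longleftrightarrow> (\<exists>(Y :: 'b topology) f. tychonoff_space Y \<and> embedding_map X Y f \<and>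
             (\<forall>\<mu> \<in> prob_measures (stone_cech Y).
                measurable_wrt (stone_cech Y) \<mu> (stone_cech_embed Y ` f ` topspace X))))
    \<and> (universally_tau_measurable X
      \<longleftrightarrow> (\<forall>(Y :: 'b topology) f. tychonoff_space Y \<and> embedding_map X Y f \<longrightarrow>
             (\<forall>\<mu> \<in> prob_measures (stone_cech Y).
                measurable_wrt (stone_cech Y) \<mu> (stone_cech_embed Y ` f ` topspace X))))"
proof -
  note X = assms(1)
  \<comment> \<open>The equivalence holds for each pair \<open>Y\<close>, \<open>f\<close>
    separately, as \<beta>Y is a compact space into which \<open>X\<close> embeds through
    \<open>Y\<close>.\<close>
  have instance_Y: "universally_tau_measurable X \<longleftrightarrow> (\<forall>\<mu> \<in> prob_measures (stone_cech Y).
      measurable_wrt (stone_cech Y) \<mu> (stone_cech_embed Y ` f ` topspace X))"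
    if Y: "tychonoff_space Y" "embedding_map X Y f" for Y :: "'b topology" and f
  proof -
    note K = compact_space_stone_cech[of Y] Hausdorff_space_stone_cech[of Y]
    have e: "embedding_map X (stone_cech Y) (stone_cech_embed Y \<circ> f)"
      by (rule embedding_map_compose[OF Y(2) embedding_map_stone_cech[OF Y(1)]])
    show ?thesis
      using universally_tau_measurable_imp_measurable_wrt[OF X _ K e]
        measurable_wrt_imp_universally_tau_measurable[OF X K e]
      unfolding image_comp[symmetric] by blast
  qed
  have instance_X: "universally_tau_measurable X \<longleftrightarrow> (\<forall>\<mu> \<in> prob_measures (stone_cech X).
      measurable_wrt (stone_cech X) \<mu> (stone_cech_embed X ` topspace X))"
    using universally_tau_measurable_imp_measurable_wrt[OF X _ compact_space_stone_cech
        Hausdorff_space_stone_cech embedding_map_stone_cech[OF X]]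
      measurable_wrt_imp_universally_tau_measurable[OF X compact_space_stone_cech
        Hausdorff_space_stone_cech embedding_map_stone_cech[OF X]]
    by blast
  obtain Y\<^sub>0 :: "'b topology" and f\<^sub>0 where "tychonoff_space Y\<^sub>0" "embedding_map X Y\<^sub>0 f\<^sub>0"
    using embedding_into_type[OF assms] by blast
  \<comment> \<open>The condition on \<open>Y\<close> and \<open>f\<close> has the same truth value
    for all admissible pairs, so one such pair makes the existential and the universal statement
    agree.\<close>
  then have "universally_tau_measurable X \<longleftrightarrow>
      (\<exists>(Y :: 'b topology) f. tychonoff_space Y \<and> embedding_map X Y f \<and>
        (\<forall>\<mu> \<in> prob_measures (stone_cech Y).
          measurable_wrt (stone_cech Y) \<mu> (stone_cech_embed Y ` f ` topspace X)))"
    "universally_tau_measurable X \<longleftrightarrow>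
      (\<forall>(Y :: 'b topology) f. tychonoff_space Y \<and> embedding_map X Y f \<longrightarrow>
        (\<forall>\<mu> \<in> prob_measures (stone_cech Y).
          measurable_wrt (stone_cech Y) \<mu> (stone_cech_embed Y ` f ` topspace X)))"
    using instance_Y by blast+
  then show ?thesis
    using instance_X by (intro conjI)
qed

end
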